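(* Let $G$ be a non-compact locally compact group. Let $1\leq p<\infty$, $p\neq 2$. There is no orthogonal representation of $G$ with vanishing coefficients on $S_{p}$ or on $L_{p}\oplus^{p} S_{p}$. Consequently, $G$ does not have property $(H_{S_{p}})$ or property $(H_{L_{p}\oplus^{p} S_{p}})$.
   Context: $\mathcal M_n$ is the algebra of $n\times n$ complex matrices; $S_p=\{\oplus_{n\ge1}x_n : x_n\in\mathcal M_n,\ \sum_n\mathrm{Tr}(|x_n|^p)<\infty\}$ with norm $\left(\sum_n\mathrm{Tr}(|x_n|^p)\right)^{1/p}$. $L_p=L_p([0,1])$ (Lebesgue measure), and $\oplus^p$ is the $\ell_p$-direct sum. For a Banach space $B$, $O(B)$ is the group of linear bijective isometries of $B$. An orthogonal representation $\pi:G\to O(B)$ is a homomorphism such that $g\mapsto \pi(g)x$ is continuous for every $x\in B$. It has vanishing coefficients if $\lim_{g\to\infty}\langle \pi(g)x,y\rangle=0$ for all $x\in B$, $y\in B^{*}$. It has almost invariant vectors if there is a sequence of unit vectors $(\xi_n)$ in $B$ with $\|\pi(g)\xi_n-\xi_n\|\to 0$ uniformly on compact subsets of $G$. $G$ has property $(H_B)$ if there exists an orthogonal representation $\pi:G\to O(B)$ with vanishing coefficients and almost invariant vectors. *)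

theory Defs
  imports
    "HOL-Analysis.Analysis"
    "HOL-Algebra.Group"
    "HOL-Algebra.Bij"
    "Jordan_Normal_Form.Schur_Decomposition"
begin

section \<open>Complex normed spaces with explicit carrier\<close>

text \<open>The spaces below depend on the real parameter \<open>p\<close>, so they cannot be types; they are
  records whose operations matter only on the carrier.\<close>

record 'v cnspace = "'v partial_object" +
  vplus :: "'v \<Rightarrow> 'v \<Rightarrow> 'v"
  vscale :: "complex \<Rightarrow> 'v \<Rightarrow> 'v"
  vnorm :: "'v \<Rightarrow> real"

definition vdist :: "'v cnspace \<Rightarrow> 'v \<Rightarrow> 'v \<Rightarrow> real" where
  "vdist B x y = vnorm B (vplus B x (vscale B (-1) y))"

definition is_linear_on :: "'v cnspace \<Rightarrow> ('v \<Rightarrow> 'v) \<Rightarrow> bool" where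
  "is_linear_on B U \<longleftrightarrow>
     (\<forall>x\<in>carrier B. \<forall>y\<in>carrier B. U (vplus B x y) = vplus B (U x) (U y)) \<and>
     (\<forall>c. \<forall>x\<in>carrier B. U (vscale B c x) = vscale B c (U x))"

text \<open>As in \<^const>\<open>BijGroup\<close>, group elements are extensional functions, so that equality
  in the group is equality on \<open>B\<close>.\<close>

definition isometry_group :: "'v cnspace \<Rightarrow> ('v \<Rightarrow> 'v) monoid" where
  "isometry_group B = (BijGroup (carrier B))
     \<lparr>carrier := {U \<in> Bij (carrier B). is_linear_on B U \<and>
                    (\<forall>x\<in>carrier B. vnorm B (U x) = vnorm B x)}\<rparr>"

definition dual_space :: "'v cnspace \<Rightarrow> ('v \<Rightarrow> complex) set" where
  "dual_space B = {\<phi>.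
     (\<forall>x\<in>carrier B. \<forall>y\<in>carrier B. \<phi> (vplus B x y) = \<phi> x + \<phi> y) \<and>
     (\<forall>c. \<forall>x\<in>carrier B. \<phi> (vscale B c x) = c * \<phi> x) \<and>
     (\<exists>C. \<forall>x\<in>carrier B. cmod (\<phi> x) \<le> C * vnorm B x)}"

definition lp_sum :: "real \<Rightarrow> 'v cnspace \<Rightarrow> 'w cnspace \<Rightarrow> ('v \<times> 'w) cnspace" where
  "lp_sum p B C = \<lparr>
     carrier = carrier B \<times> carrier C,
     vplus = (\<lambda>x y. (vplus B (fst x) (fst y), vplus C (snd x) (snd y))),
     vscale = (\<lambda>c x. (vscale B c (fst x), vscale C c (snd x))),
     vnorm = (\<lambda>x. (vnorm B (fst x) powr p + vnorm C (snd x) powr p) powr (1 / p))\<rparr>"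

section \<open>The space \<open>L\<^sub>p([0,1])\<close>\<close>

text \<open>Measurable functions on \<open>[0,1]\<close> modulo equality almost everywhere; \<open>L\<^sub>p\<close> is a subset of
  this type for every \<open>p\<close>.\<close>

definition ae_eq :: "(real \<Rightarrow> complex) \<Rightarrow> (real \<Rightarrow> complex) \<Rightarrow> bool" where
  "ae_eq f g \<longleftrightarrow> f \<in> borel_measurable (lebesgue_on {0..1}) \<and>
     g \<in> borel_measurable (lebesgue_on {0..1}) \<and>
     (AE t in lebesgue_on {0..1}. f t = g t)"

lemma part_equivp_ae_eq: "part_equivp ae_eq"
proof (rule part_equivpI)
  show "\<exists>f. ae_eq f f"
    by (rule exI[of _ "\<lambda>_. 0"]) (simp add: ae_eq_def)
  show "symp ae_eq"
    by (auto simp: symp_def ae_eq_def elim: eventually_mono)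
  show "transp ae_eq"
    unfolding transp_def ae_eq_def by (auto elim: eventually_elim2)
qed

quotient_type ae_fun = "real \<Rightarrow> complex" / partial: ae_eq
  by (rule part_equivp_ae_eq)

lift_definition ae_plus :: "ae_fun \<Rightarrow> ae_fun \<Rightarrow> ae_fun" is "\<lambda>f g t. f t + g t"
  unfolding ae_eq_def by (auto elim: eventually_elim2)

lift_definition ae_scale :: "complex \<Rightarrow> ae_fun \<Rightarrow> ae_fun" is "\<lambda>c f t. c * f t"
  unfolding ae_eq_def by (auto elim: eventually_mono)

lift_definition Lp_member :: "real \<Rightarrow> ae_fun \<Rightarrow> bool" is
  "\<lambda>p f. integrable (lebesgue_on {0..1}) (\<lambda>t. cmod (f t) powr p)"
  unfolding ae_eq_def by (rule integrable_cong_AE) (auto elim: eventually_mono)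

lift_definition Lp_norm :: "real \<Rightarrow> ae_fun \<Rightarrow> real" is
  "\<lambda>p f. (LINT t|lebesgue_on {0..1}. cmod (f t) powr p) powr (1 / p)"
  unfolding ae_eq_def
  by (rule arg_cong[where f = "\<lambda>x. x powr _"], rule integral_cong_AE) (auto elim: eventually_mono)

definition Lp_space :: "real \<Rightarrow> ae_fun cnspace" where
  "Lp_space p = \<lparr>carrier = {f. Lp_member p f}, vplus = ae_plus, vscale = ae_scale,
     vnorm = Lp_norm p\<rparr>"

section \<open>The space \<open>S\<^sub>p\<close>\<close>

definition mat_tr :: "complex mat \<Rightarrow> complex" where
  "mat_tr A = (\<Sum>i<dim_row A. A $$ (i, i))"

text \<open>Functional calculus: \<open>f(U diag(d) U\<^sup>*) = U diag(f \<circ> d) U\<^sup>*\<close> for \<open>U\<close> unitary and \<open>d\<close> real.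
  The matrix \<open>f(A)\<close> exists by the spectral theorem and does not depend on the diagonalization
  of the Hermitian matrix \<open>A\<close>.\<close>

definition hermitian_fun :: "(real \<Rightarrow> real) \<Rightarrow> complex mat \<Rightarrow> complex mat" where
  "hermitian_fun f A = (let n = dim_row A in
     THE B. \<exists>U d. U \<in> carrier_mat n n \<and> mat_adjoint U * U = 1\<^sub>m n \<and>
       A = U * mat_diag n (\<lambda>i. complex_of_real (d i)) * mat_adjoint U \<and>
       B = U * mat_diag n (\<lambda>i. complex_of_real (f (d i))) * mat_adjoint U)"

definition mat_abs :: "complex mat \<Rightarrow> complex mat" where
  "mat_abs x = hermitian_fun sqrt (mat_adjoint x * x)"

text \<open>The trace is a nonnegative real number; \<^const>\<open>Re\<close> only changes the type.\<close>

definition tr_abs_powr :: "real \<Rightarrow> complex mat \<Rightarrow> real" where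
  "tr_abs_powr p x = Re (mat_tr (hermitian_fun (\<lambda>t. t powr p) (mat_abs x)))"

text \<open>Blocks are indexed from 0: \<open>x k\<close> is the block of size \<open>k + 1\<close>.\<close>

definition Sp_space :: "real \<Rightarrow> (nat \<Rightarrow> complex mat) cnspace" where
  "Sp_space p = \<lparr>
     carrier = {x. (\<forall>k. x k \<in> carrier_mat (Suc k) (Suc k)) \<and>
                   summable (\<lambda>k. tr_abs_powr p (x k))},
     vplus = (\<lambda>x y k. x k + y k),
     vscale = (\<lambda>c x k. c \<cdot>\<^sub>m x k),
     vnorm = (\<lambda>x. (\<Sum>k. tr_abs_powr p (x k)) powr (1 / p))\<rparr>"

section \<open>Orthogonal representations\<close>

locale topological_group = group G for G (structure) +
  fixes T
  assumes topspace_eq: "topspace T = carrier G"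
    and continuous_mult: "continuous_map (prod_topology T T) T (\<lambda>(g, h). g \<otimes> h)"
    and continuous_inv: "continuous_map T T (\<lambda>g. inv g)"

text \<open>The last conjunct is continuity of \<open>g \<mapsto> \<pi> g x\<close> into the norm topology.\<close>

definition orthogonal_rep ::
  "('g, 'm) monoid_scheme \<Rightarrow> 'g topology \<Rightarrow> 'v cnspace \<Rightarrow> ('g \<Rightarrow> 'v \<Rightarrow> 'v) \<Rightarrow> bool" where
  "orthogonal_rep G T B \<pi> \<longleftrightarrow>
     \<pi> \<in> hom G (isometry_group B) \<and>
     (\<forall>x\<in>carrier B. \<forall>g\<in>carrier G. \<forall>\<epsilon>>0. \<exists>W. openin T W \<and> g \<in> W \<and>
        (\<forall>h\<in>W. vdist B (\<pi> h x) (\<pi> g x) < \<epsilon>))"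

definition vanishing_coefficients ::
  "'g topology \<Rightarrow> 'v cnspace \<Rightarrow> ('g \<Rightarrow> 'v \<Rightarrow> 'v) \<Rightarrow> bool" where
  "vanishing_coefficients T B \<pi> \<longleftrightarrow>
     (\<forall>x\<in>carrier B. \<forall>\<phi>\<in>dual_space B. \<forall>\<epsilon>>0. \<exists>K. compactin T K \<and>
        (\<forall>g\<in>topspace T - K. cmod (\<phi> (\<pi> g x)) < \<epsilon>))"

definition almost_invariant_vectors ::
  "'g topology \<Rightarrow> 'v cnspace \<Rightarrow> ('g \<Rightarrow> 'v \<Rightarrow> 'v) \<Rightarrow> bool" where
  "almost_invariant_vectors T B \<pi> \<longleftrightarrow>
     (\<exists>\<xi>. (\<forall>n. \<xi> n \<in> carrier B \<and> vnorm B (\<xi> n) = 1) \<and>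
        (\<forall>K. compactin T K \<longrightarrow>
           uniform_limit K (\<lambda>(n::nat) g. vdist B (\<pi> g (\<xi> n)) (\<xi> n)) (\<lambda>_. 0) sequentially))"

definition property_H ::
  "('g, 'm) monoid_scheme \<Rightarrow> 'g topology \<Rightarrow> 'v cnspace \<Rightarrow> bool" where
  "property_H G T B \<longleftrightarrow>
     (\<exists>\<pi>. orthogonal_rep G T B \<pi> \<and> vanishing_coefficients T B \<pi> \<and>
          almost_invariant_vectors T B \<pi>)"

end

theory Submission
  imports Defs "Jordan_Normal_Form.Spectral_Radius"
begin

text \<open>Write \<open>e\<close> for the element of \<open>S\<^sub>p\<close> whose \<open>1 \<times> 1\<close> block is \<open>1\<close> and whose other blocks vanish. The
  point of the proof is that every surjective linear isometry \<open>U\<close> of \<open>S\<^sub>p\<close>, or of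
  \<open>L\<^sub>p \<oplus> S\<^sub>p\<close>, maps \<open>e\<close> to a multiple of itself. Hence for an orthogonal representation \<open>\<pi>\<close> and the
  bounded functional \<open>\<phi>\<close> that reads off the \<open>1 \<times> 1\<close> block, \<open>|\<phi>(\<pi>(g) e)| = 1\<close> for all \<open>g\<close>, and
  such a coefficient can vanish at infinity only if the group is compact
  (\<open>compact_if_vanishing_coefficients\<close>).

  The line through \<open>e\<close> is recognised by a property that isometries preserve. Call \<open>x\<close> and \<open>y\<close>
  orthogonal if they span an \<open>l\<^sub>p\<close>-sum, that is
  \<open>\<parallel>a x + b y\<parallel>\<^sup>p = |a|\<^sup>p \<parallel>x\<parallel>\<^sup>p + |b|\<^sup>p \<parallel>y\<parallel>\<^sup>p\<close> for all scalars, and call a nonzero \<open>v\<close> an atom if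
  every vector is a multiple of \<open>v\<close> plus a vector orthogonal to \<open>v\<close>; so \<open>v\<close> spans a one-dimensional
  \<open>l\<^sub>p\<close>-summand. Obviously \<open>e\<close> is an atom. The condition \<open>p \<noteq> 2\<close> enters through one fact about the plane
  (\<open>l2p_no_transversal_splitting\<close>): a vector that is a sum of two nonzero orthogonal vectors is
  not an atom (\<open>p_atom_not_divisible\<close>). In a Hilbert space, in contrast, every nonzero vector is an atom.

  This excludes all other candidates. A nonzero function on \<open>[0,1]\<close> can be cut at a point
  into two orthogonal pieces (\<open>Lp_p_divisible\<close>), so an atom of \<open>L\<^sub>p \<oplus> S\<^sub>p\<close> has no
  \<open>L\<^sub>p\<close>-component (\<open>p_atom_second\<close>). Different blocks of \<open>S\<^sub>p\<close> are orthogonal, so an atom lives in one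
  block, of size \<open>n\<close> say. If \<open>n \<ge> 2\<close>, some self-adjoint unitary \<open>u\<close> moves the line of
  the block \<open>x\<close> of the atom. Left multiplication by \<open>u\<close> is an isometry, so \<open>u x\<close> is another atom, and two atoms
  which are not parallel are orthogonal (\<open>p_atoms_parallel_or_orth\<close>). But \<open>(1 + \<i> u) / \<surd>2\<close> is
  unitary too, so \<open>\<parallel>(x + \<i> u x) / \<surd>2\<parallel> = \<parallel>x\<parallel>\<close>, whereas orthogonality gives the value
  \<open>2\<^bsup>1/p - 1/2\<^esup> \<parallel>x\<parallel>\<close>, which is different for \<open>p \<noteq> 2\<close>. So \<open>n = 1\<close>.

  On the side of matrices this uses three properties of \<open>Tr |x|\<^sup>p\<close>: it is homogeneous,
  it is positive definite, and it is invariant under left multiplication by unitaries. The last holds because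
  \<open>(u x)\<^sup>* (u x) = x\<^sup>* x\<close>; the others follow from the spectral theorem for \<open>x\<^sup>* x\<close>.\<close>

section \<open>Unitary matrices and the spectral theorem\<close>

lemma times_mat_index:
  assumes "A \<in> carrier_mat n m" "B \<in> carrier_mat m l" "i < n" "j < l"
  shows "(A * B) $$ (i, j) = (\<Sum>k<m. A $$ (i, k) * B $$ (k, j))"
  using assms by (auto simp: scalar_prod_def atLeast0LessThan intro!: sum.cong)

lemma mat_adjoint_index:
  fixes A :: "complex mat"
  assumes "i < dim_col A" "j < dim_row A"
  shows "mat_adjoint A $$ (i, j) = cnj (A $$ (j, i))"
  using assms by (simp add: mat_adjoint_def mat_of_rows_def)

lemma mat_adjoint_dim [simp]:
  fixes A :: "complex mat"
  shows "dim_row (mat_adjoint A) = dim_col A" "dim_col (mat_adjoint A) = dim_row A"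
  by (simp_all add: mat_adjoint_def)

lemma mat_adjoint_carrier [simp]:
  fixes A :: "complex mat"
  assumes "A \<in> carrier_mat n m"
  shows "mat_adjoint A \<in> carrier_mat m n"
  by (rule carrier_matI) (use assms in simp_all)

lemma mat_adjoint_times:
  fixes A B :: "complex mat"
  assumes A: "A \<in> carrier_mat n m" and B: "B \<in> carrier_mat m l"
  shows "mat_adjoint (A * B) = mat_adjoint B * mat_adjoint A"
proof (rule eq_matI)
  fix i j assume "i < dim_row (mat_adjoint B * mat_adjoint A)" "j < dim_col (mat_adjoint B * mat_adjoint A)"
  hence ij: "i < l" "j < n" using A B by auto
  show "mat_adjoint (A * B) $$ (i, j) = (mat_adjoint B * mat_adjoint A) $$ (i, j)"
  proof -
    have "mat_adjoint (A * B) $$ (i, j) = (\<Sum>k<m. cnj (A $$ (j, k)) * cnj (B $$ (k, i)))"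
      using ij A B by (subst mat_adjoint_index) (auto simp: times_mat_index[OF A B] simp del: index_mult_mat(1))
    also have "\<dots> = (\<Sum>k<m. mat_adjoint B $$ (i, k) * mat_adjoint A $$ (k, j))"
      using ij A B by (intro sum.cong refl) (simp add: mat_adjoint_index mult.commute)
    also have "\<dots> = (mat_adjoint B * mat_adjoint A) $$ (i, j)"
      by (rule times_mat_index[symmetric]) (use ij A B in auto)
    finally show ?thesis .
  qed
qed (use A B in auto)

lemma mat_adjoint_adjoint [simp]:
  fixes A :: "complex mat"
  shows "mat_adjoint (mat_adjoint A) = A"
  by (rule eq_matI) (simp_all add: mat_adjoint_index)

lemma mat_adjoint_smult:
  fixes A :: "complex mat"
  shows "mat_adjoint (c \<cdot>\<^sub>m A) = cnj c \<cdot>\<^sub>m mat_adjoint A"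
  by (rule eq_matI) (simp_all add: mat_adjoint_index)

definition unitary_mat :: "nat \<Rightarrow> complex mat \<Rightarrow> bool" where
  "unitary_mat n U \<longleftrightarrow> U \<in> carrier_mat n n \<and> mat_adjoint U * U = 1\<^sub>m n"

lemma unitary_mat_right:
  assumes "unitary_mat n U"
  shows "U * mat_adjoint U = 1\<^sub>m n"
  by (rule mat_mult_left_right_inverse[of "mat_adjoint U" n U])
     (use assms in \<open>simp_all add: unitary_mat_def\<close>)

lemma unitary_mat_times:
  assumes "unitary_mat n U" "unitary_mat n V"
  shows "unitary_mat n (U * V)"
proof -
  have c: "U \<in> carrier_mat n n" "V \<in> carrier_mat n n"
    and ca: "mat_adjoint U \<in> carrier_mat n n" "mat_adjoint V \<in> carrier_mat n n"
    using assms by (auto simp: unitary_mat_def)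
  have "mat_adjoint (U * V) * (U * V) = mat_adjoint V * ((mat_adjoint U * U) * V)"
    using c ca by (simp add: mat_adjoint_times[OF c] assoc_mult_mat[where n\<^sub>1 = n and n\<^sub>2 = n and n\<^sub>3 = n and n\<^sub>4 = n])
  also have "\<dots> = 1\<^sub>m n" using assms c by (simp add: unitary_mat_def)
  finally show ?thesis using c by (simp add: unitary_mat_def)
qed

text \<open>Complete \<open>v\<close> to a basis, apply the Gram-Schmidt process, which keeps the first vector, and
  normalize the columns.\<close>

lemma unitary_mat_with_first_column:
  assumes n: "n \<noteq> 0" and v: "v \<in> carrier_vec n" and v0: "v \<noteq> 0\<^sub>v n"
  obtains U a where "unitary_mat n U" "col U 0 = a \<cdot>\<^sub>v v"
proof -
  interpret cof_vec_space n "TYPE(complex)" .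
  define b where "b = basis_completion v"
  define ws where "ws = gram_schmidt n b"
  from basis_completion[OF v v0, folded b_def]
  have dist_b: "distinct b"
    and indep: "\<not> lin_dep (set b)" and b: "set b \<subseteq> carrier_vec n" and hdb: "hd b = v"
    and len_b: "length b = n" by auto
  from hdb len_b n obtain vs where bv: "b = v # vs" by (cases b, auto)
  from gram_schmidt_result[OF b dist_b indep refl, folded ws_def]
  have ws: "set ws \<subseteq> carrier_vec n" "corthogonal ws" "length ws = n"
    by (auto simp: len_b)
  from gram_schmidt_hd[OF v, of vs, folded bv] have hdws: "hd ws = v" unfolding ws_def .
  define s where "s i = complex_of_real (1 / sqrt (Re (ws ! i \<bullet>c ws ! i)))" for i
  define U where "U = mat_of_cols n (map (\<lambda>i. s i \<cdot>\<^sub>v ws ! i) [0..<n])"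
  have wsi: "ws ! i \<in> carrier_vec n" if "i < n" for i using ws that by auto
  have U: "U \<in> carrier_mat n n" unfolding U_def by (auto simp: mat_of_cols_def)
  have Ucol: "col U i = s i \<cdot>\<^sub>v ws ! i" if "i < n" for i
    unfolding U_def by (subst col_mat_of_cols) (use that wsi in auto)
  \<comment> \<open>In the order of the complex numbers, \<open>0 \<le> z\<close> includes that \<open>z\<close> is real.\<close>
  have s1: "s i * cnj (s i) * (ws ! i \<bullet>c ws ! i) = 1" if i: "i < n" for i
  proof -
    have "ws ! i \<bullet>c ws ! i \<noteq> 0" using corthogonalD[OF ws(2), of i i] i ws by auto
    moreover have "ws ! i \<bullet>c ws ! i \<ge> 0" by (rule conjugate_square_ge_0_vec)
    ultimately obtain r where r: "ws ! i \<bullet>c ws ! i = complex_of_real r" "r > 0"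
      by (metis complex_eq_iff less_eq_complex_def Re_complex_of_real Im_complex_of_real zero_complex.simps order_le_less)
    have "sqrt r * sqrt r = r" using r by simp
    thus ?thesis using r unfolding s_def r by (simp flip: of_real_mult add: field_simps)
  qed
  have "mat_adjoint U * U = 1\<^sub>m n"
  proof (rule eq_matI)
    fix i j assume "i < dim_row (1\<^sub>m n :: complex mat)" "j < dim_col (1\<^sub>m n :: complex mat)"
    hence ij: "i < n" "j < n" by auto
    have "(mat_adjoint U * U) $$ (i, j) = col U j \<bullet>c col U i"
      using ij U by (auto simp: scalar_prod_def mat_adjoint_index intro!: sum.cong)
    also have "\<dots> = s j * cnj (s i) * (ws ! j \<bullet>c ws ! i)"
      using wsi[OF ij(1)] wsi[OF ij(2)] by (simp add: Ucol ij conjugate_smult_vec mult_ac)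
    also have "\<dots> = (1\<^sub>m n) $$ (i, j)"
      using corthogonalD[OF ws(2), of j i] ij ws s1 by (cases "i = j") auto
    finally show "(mat_adjoint U * U) $$ (i, j) = (1\<^sub>m n) $$ (i, j)" .
  qed (use U in auto)
  moreover have "col U 0 = s 0 \<cdot>\<^sub>v v" using Ucol[of 0] n hdws ws by (cases ws) auto
  ultimately show ?thesis using that U by (auto simp: unitary_mat_def)
qed

definition unitary_diag :: "nat \<Rightarrow> complex mat \<Rightarrow> (nat \<Rightarrow> real) \<Rightarrow> complex mat" where
  "unitary_diag n U d = U * mat_diag n (\<lambda>i. complex_of_real (d i)) * mat_adjoint U"

lemma unitary_diag_carrier:
  "U \<in> carrier_mat n n \<Longrightarrow> unitary_diag n U d \<in> carrier_mat n n"
  unfolding unitary_diag_def by (intro mult_carrier_mat[where n = n]) simp_all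

lemma unitary_diag_index:
  assumes U: "U \<in> carrier_mat n n" and ij: "i < n" "j < n"
  shows "unitary_diag n U d $$ (i, j) = (\<Sum>k<n. U $$ (i, k) * of_real (d k) * cnj (U $$ (j, k)))"
proof -
  have "(U * mat_diag n (\<lambda>i. complex_of_real (d i))) \<in> carrier_mat n n"
    by (intro mult_carrier_mat[where n = n]) (simp_all add: U)
  hence "unitary_diag n U d $$ (i, j) =
      (\<Sum>k<n. (U * mat_diag n (\<lambda>i. complex_of_real (d i))) $$ (i, k) * mat_adjoint U $$ (k, j))"
    unfolding unitary_diag_def by (rule times_mat_index) (use U ij in simp_all)
  also have "\<dots> = (\<Sum>k<n. U $$ (i, k) * of_real (d k) * cnj (U $$ (j, k)))"
    using U ij by (intro sum.cong refl) (simp add: mat_diag_mult_right[OF U] mat_adjoint_index)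
  finally show ?thesis .
qed

lemma unitary_mat_index:
  assumes "unitary_mat n U" "i < n" "j < n"
  shows "(\<Sum>k<n. cnj (U $$ (k, i)) * U $$ (k, j)) = (if i = j then 1 else 0)"
proof -
  have U: "U \<in> carrier_mat n n" "mat_adjoint U * U = 1\<^sub>m n" using assms by (auto simp: unitary_mat_def)
  have "(mat_adjoint U * U) $$ (i, j) = (\<Sum>k<n. mat_adjoint U $$ (i, k) * U $$ (k, j))"
    by (rule times_mat_index) (use U assms in auto)
  also have "\<dots> = (\<Sum>k<n. cnj (U $$ (k, i)) * U $$ (k, j))"
    using U assms by (intro sum.cong refl) (simp add: mat_adjoint_index)
  finally show ?thesis using U assms by simp
qed

lemma unitary_matI:
  assumes U: "U \<in> carrier_mat n n"
    and "\<And>i j. i < n \<Longrightarrow> j < n \<Longrightarrow> (\<Sum>k<n. cnj (U $$ (k, i)) * U $$ (k, j)) = (if i = j then 1 else 0)"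
  shows "unitary_mat n U"
proof -
  have "mat_adjoint U * U = 1\<^sub>m n"
  proof (rule eq_matI)
    fix i j assume "i < dim_row (1\<^sub>m n :: complex mat)" "j < dim_col (1\<^sub>m n :: complex mat)"
    hence ij: "i < n" "j < n" by auto
    have "(mat_adjoint U * U) $$ (i, j) = (\<Sum>k<n. mat_adjoint U $$ (i, k) * U $$ (k, j))"
      by (rule times_mat_index) (use U ij in auto)
    also have "\<dots> = (\<Sum>k<n. cnj (U $$ (k, i)) * U $$ (k, j))"
      using U ij by (intro sum.cong refl) (simp add: mat_adjoint_index)
    finally show "(mat_adjoint U * U) $$ (i, j) = 1\<^sub>m n $$ (i, j)" using ij assms(2)[OF ij] by simp
  qed (use U in auto)
  thus ?thesis using U by (simp add: unitary_mat_def)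
qed

lemma unitary_diag_unitary_diag:
  assumes U: "U \<in> carrier_mat n n" and V: "V \<in> carrier_mat n n"
  shows "U * unitary_diag n V d * mat_adjoint U = unitary_diag n (U * V) d"
  using assms unfolding unitary_diag_def mat_adjoint_times[OF U V]
  by (simp add: assoc_mult_mat[where n\<^sub>1 = n and n\<^sub>2 = n and n\<^sub>3 = n and n\<^sub>4 = n]
        mult_carrier_mat[where nr = n and n = n and nc = n])

text \<open>The spectral theorem, by induction on the size. A unitary \<open>U\<close> whose first column is an eigenvector turns
  \<open>A\<close> into \<open>B = U\<^sup>* A U\<close> with first column \<open>(e, 0, \<dots>, 0)\<close>; as \<open>B\<close> is Hermitian, its first row has the
  same form and \<open>e\<close> is real, and the remaining square block is diagonalized by the induction
  hypothesis.\<close>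

theorem hermitian_unitary_diag:
  assumes "A \<in> carrier_mat n n" "mat_adjoint A = A"
  shows "\<exists>U d. unitary_mat n U \<and> A = unitary_diag n U d"
  using assms
proof (induction n arbitrary: A)
  case 0
  have "unitary_mat 0 (1\<^sub>m 0)" by (rule unitary_matI) auto
  moreover have "A = unitary_diag 0 (1\<^sub>m 0) (\<lambda>_. 0)"
    using 0 carrier_matD[OF unitary_diag_carrier[of "1\<^sub>m 0" 0 "\<lambda>_. 0"]] by (intro eq_matI) auto
  ultimately show ?case by blast
next
  case (Suc n)
  have A: "A \<in> carrier_mat (Suc n) (Suc n)" by fact
  obtain e where "eigenvalue A e"
    using spectrum_non_empty[OF A] unfolding spectrum_def by auto
  then obtain v where v: "v \<in> carrier_vec (Suc n)" "v \<noteq> 0\<^sub>v (Suc n)" "A *\<^sub>v v = e \<cdot>\<^sub>v v"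
    using A unfolding eigenvalue_def eigenvector_def by auto
  from unitary_mat_with_first_column[OF _ v(1,2)]
  obtain U a where U: "unitary_mat (Suc n) U" and Ucol: "col U 0 = a \<cdot>\<^sub>v v" by blast
  have Uc: "U \<in> carrier_mat (Suc n) (Suc n)" using U by (simp add: unitary_mat_def)
  define B where "B = mat_adjoint U * (A * U)"
  have B: "B \<in> carrier_mat (Suc n) (Suc n)" unfolding B_def
    using A Uc by (intro mult_carrier_mat[where n = "Suc n"]) simp_all
  have AU: "A * U \<in> carrier_mat (Suc n) (Suc n)"
    using A Uc by (intro mult_carrier_mat[where n = "Suc n"]) simp_all
  have "mat_adjoint B = B"
    using A Uc AU Suc.prems(2) unfolding B_def
    by (simp add: mat_adjoint_times[where n = "Suc n" and m = "Suc n" and l = "Suc n"]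
        assoc_mult_mat[where n\<^sub>1 = "Suc n" and n\<^sub>2 = "Suc n" and n\<^sub>3 = "Suc n" and n\<^sub>4 = "Suc n"])
  hence Bherm: "B $$ (i, j) = cnj (B $$ (j, i))" if "i < Suc n" "j < Suc n" for i j
    using mat_adjoint_index[of i B j] B that by auto
  have A_B: "A = U * B * mat_adjoint U"
  proof -
    have Ua: "mat_adjoint U \<in> carrier_mat (Suc n) (Suc n)" using Uc by simp
    have "U * B * mat_adjoint U = (U * mat_adjoint U) * A * (U * mat_adjoint U)"
      unfolding B_def using A Uc Ua AU
      by (simp add: assoc_mult_mat[where n\<^sub>1 = "Suc n" and n\<^sub>2 = "Suc n" and n\<^sub>3 = "Suc n" and n\<^sub>4 = "Suc n"]
          mult_carrier_mat[where nr = "Suc n" and n = "Suc n" and nc = "Suc n"])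
    also have "\<dots> = A" using A unitary_mat_right[OF U] by simp
    finally show ?thesis by simp
  qed
  have AUcol: "(A * U) $$ (k, 0) = e * U $$ (k, 0)" if "k < Suc n" for k
  proof -
    have "col (A * U) 0 = A *\<^sub>v (a \<cdot>\<^sub>v v)" using A Uc Ucol by (subst col_mult2[OF A Uc]) auto
    also have "\<dots> = e \<cdot>\<^sub>v col U 0" using A v Ucol by (simp add: mult_mat_vec[OF A] smult_smult_assoc mult.commute)
    finally have "vec_index (col (A * U) 0) k = vec_index (e \<cdot>\<^sub>v col U 0) k" by simp
    thus ?thesis using A Uc that by simp
  qed
  have Bcol: "B $$ (i, 0) = (if i = 0 then e else 0)" if i: "i < Suc n" for i
  proof -
    have "B $$ (i, 0) = (\<Sum>k<Suc n. mat_adjoint U $$ (i, k) * (A * U) $$ (k, 0))"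
      unfolding B_def by (rule times_mat_index[OF _ AU]) (use i Uc in auto)
    also have "\<dots> = (\<Sum>k<Suc n. e * (cnj (U $$ (k, i)) * U $$ (k, 0)))"
      by (intro sum.cong refl) (use i Uc AUcol in \<open>simp add: mat_adjoint_index\<close>)
    also have "\<dots> = e * (if i = 0 then 1 else 0)"
      using unitary_mat_index[OF U i, of 0] by (simp only: sum_distrib_left[symmetric])
    finally show ?thesis by simp
  qed
  have e: "e = complex_of_real (Re e)" using Bherm[of 0 0] Bcol[of 0] by (simp add: complex_eq_iff)
  have Brow: "B $$ (0, i) = (if i = 0 then e else 0)" if i: "i < Suc n" for i
    using Bherm[of 0 i] Bcol[OF i] Bcol[of 0] i by (cases "i = 0") auto
  define A' where "A' = Matrix.mat n n (\<lambda>(i, j). B $$ (Suc i, Suc j))"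
  have "mat_adjoint A' = A'"
    by (rule eq_matI) (auto simp: A'_def mat_adjoint_index intro: Bherm[symmetric])
  with Suc.IH[of A'] obtain V d where V: "unitary_mat n V" and A': "A' = unitary_diag n V d"
    by (auto simp: A'_def)
  define W where "W = Matrix.mat (Suc n) (Suc n)
    (\<lambda>(i, j). case (i, j) of (Suc i', Suc j') \<Rightarrow> V $$ (i', j') | (0, 0) \<Rightarrow> 1 | _ \<Rightarrow> 0)"
  have W: "W \<in> carrier_mat (Suc n) (Suc n)" by (simp add: W_def)
  have Wi: "W $$ (0, 0) = 1" "\<And>i. i < n \<Longrightarrow> W $$ (Suc i, 0) = 0" "\<And>i. i < n \<Longrightarrow> W $$ (0, Suc i) = 0"
    "\<And>i j. i < n \<Longrightarrow> j < n \<Longrightarrow> W $$ (Suc i, Suc j) = V $$ (i, j)"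
    by (simp_all add: W_def)
  have Wu: "unitary_mat (Suc n) W"
  proof (rule unitary_matI[OF W])
    fix i j assume ij: "i < Suc n" "j < Suc n"
    show "(\<Sum>k<Suc n. cnj (W $$ (k, i)) * W $$ (k, j)) = (if i = j then 1 else 0)"
      using ij unitary_mat_index[OF V]
      by (cases i; cases j) (simp_all add: sum.lessThan_Suc_shift Wi del: sum.lessThan_Suc)
  qed
  have "B = unitary_diag (Suc n) W (case_nat (Re e) d)"
  proof (rule eq_matI)
    have dim: "unitary_diag (Suc n) W (case_nat (Re e) d) \<in> carrier_mat (Suc n) (Suc n)"
      using W by (rule unitary_diag_carrier)
    thus "dim_row B = dim_row (unitary_diag (Suc n) W (case_nat (Re e) d))"
      "dim_col B = dim_col (unitary_diag (Suc n) W (case_nat (Re e) d))" using B by auto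
    have Vc: "V \<in> carrier_mat n n" using V by (simp add: unitary_mat_def)
    have low: "B $$ (Suc i, Suc j) = (\<Sum>k<n. V $$ (i, k) * of_real (d k) * cnj (V $$ (j, k)))"
      if "i < n" "j < n" for i j
    proof -
      have "B $$ (Suc i, Suc j) = A' $$ (i, j)" using that by (simp add: A'_def)
      thus ?thesis unfolding A' unitary_diag_index[OF Vc that, of d] .
    qed
    fix i j assume "i < dim_row (unitary_diag (Suc n) W (case_nat (Re e) d))"
      "j < dim_col (unitary_diag (Suc n) W (case_nat (Re e) d))"
    hence ij: "i < Suc n" "j < Suc n" using dim by auto
    show "B $$ (i, j) = unitary_diag (Suc n) W (case_nat (Re e) d) $$ (i, j)"
      using ij low Bcol Brow e
      by (cases i; cases j)
        (simp_all add: unitary_diag_index[OF W] sum.lessThan_Suc_shift Wi del: sum.lessThan_Suc)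
  qed
  hence "A = unitary_diag (Suc n) (U * W) (case_nat (Re e) d)"
    using unitary_diag_unitary_diag[OF Uc W] A_B by simp
  thus ?case using unitary_mat_times[OF U Wu] by blast
qed

section \<open>The functional calculus and the trace of powers of the absolute value\<close>

text \<open>The functional calculus is well defined: \<open>W = V\<^sup>* U\<close> intertwines the two diagonal matrices, so
  \<open>W\<^sub>i\<^sub>j\<close> can be nonzero only where \<open>d\<^sub>j = e\<^sub>i\<close>, and hence \<open>W\<close> also intertwines the diagonal matrices of
  \<open>f \<circ> d\<close> and \<open>f \<circ> e\<close>.\<close>

lemma unitary_diag_unique_calculus:
  assumes U: "unitary_mat n U" and V: "unitary_mat n V"
    and eq: "unitary_diag n U d = unitary_diag n V e"
  shows "unitary_diag n U (\<lambda>i. f (d i)) = unitary_diag n V (\<lambda>i. f (e i))"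
proof -
  let ?D = "\<lambda>d. mat_diag n (\<lambda>i. complex_of_real (d i))"
  have Uc: "U \<in> carrier_mat n n" "mat_adjoint U \<in> carrier_mat n n" "mat_adjoint U * U = 1\<^sub>m n" "U * mat_adjoint U = 1\<^sub>m n"
    and Vc: "V \<in> carrier_mat n n" "mat_adjoint V \<in> carrier_mat n n" "mat_adjoint V * V = 1\<^sub>m n" "V * mat_adjoint V = 1\<^sub>m n"
    using U V unitary_mat_right by (auto simp: unitary_mat_def)
  note assoc = assoc_mult_mat[where n\<^sub>1 = n and n\<^sub>2 = n and n\<^sub>3 = n and n\<^sub>4 = n]
    and closed = mult_carrier_mat[where nr = n and n = n and nc = n]
      right_mult_one_mat[where nr = n and nc = n] left_mult_one_mat[where nr = n and nc = n]
  define W where "W = mat_adjoint V * U"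
  have W: "W \<in> carrier_mat n n" using Uc Vc by (simp add: W_def closed)
  have "W * ?D d = mat_adjoint V * (U * ?D d * mat_adjoint U) * U"
    using Uc Vc by (simp add: W_def assoc closed)
  also have "\<dots> = mat_adjoint V * (V * ?D e * mat_adjoint V) * U"
    using eq by (simp add: unitary_diag_def)
  also have "\<dots> = (mat_adjoint V * V) * (?D e * (mat_adjoint V * U))"
    using Uc(1,2) Vc(1,2) by (simp add: assoc closed)
  also have "\<dots> = ?D e * W" using Uc Vc by (simp add: W_def closed)
  finally have comm: "W * ?D d = ?D e * W" .
  have "W $$ (i, j) * of_real (f (d j)) = of_real (f (e i)) * W $$ (i, j)" if ij: "i < n" "j < n" for i j
  proof -
    have "W $$ (i, j) * of_real (d j) = of_real (e i) * W $$ (i, j)"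
      using arg_cong[OF comm, of "\<lambda>A. A $$ (i, j)"] ij
      by (simp add: mat_diag_mult_right[OF W] mat_diag_mult_left[OF W])
    thus ?thesis by (cases "W $$ (i, j) = 0") auto
  qed
  hence comm_f: "W * ?D (\<lambda>i. f (d i)) = ?D (\<lambda>i. f (e i)) * W"
    unfolding mat_diag_mult_right[OF W] mat_diag_mult_left[OF W] by (intro eq_matI) simp_all
  have "unitary_diag n U (\<lambda>i. f (d i)) = (V * mat_adjoint V) * U * ?D (\<lambda>i. f (d i)) * mat_adjoint U"
    using Uc Vc by (simp add: unitary_diag_def)
  also have "\<dots> = V * (W * ?D (\<lambda>i. f (d i))) * mat_adjoint U"
    using Uc(1,2) Vc(1,2) by (simp add: W_def assoc closed)
  also have "\<dots> = V * ?D (\<lambda>i. f (e i)) * mat_adjoint V * (U * mat_adjoint U)"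
    unfolding comm_f using Uc(1,2) Vc(1,2) by (simp add: W_def assoc closed)
  also have "\<dots> = unitary_diag n V (\<lambda>i. f (e i))"
    using Uc Vc by (simp add: unitary_diag_def closed)
  finally show ?thesis .
qed

lemma hermitian_fun_unitary_diag:
  assumes U: "unitary_mat n U"
  shows "hermitian_fun f (unitary_diag n U d) = unitary_diag n U (\<lambda>i. f (d i))"
proof -
  have dim: "dim_row (unitary_diag n U d) = n"
    using unitary_diag_carrier[of U n d] U by (auto simp: unitary_mat_def)
  show ?thesis
    unfolding hermitian_fun_def dim Let_def
  proof (rule the_equality, goal_cases)
    case 1
    show ?case using U unfolding unitary_mat_def unitary_diag_def by blast
  next
    case (2 B)
    then obtain V e where V: "unitary_mat n V" and "unitary_diag n U d = unitary_diag n V e"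
      and B: "B = unitary_diag n V (\<lambda>i. f (e i))"
      unfolding unitary_mat_def unitary_diag_def by blast
    thus ?case using unitary_diag_unique_calculus[OF U V] by simp
  qed
qed

lemma mat_tr_unitary_diag:
  assumes U: "unitary_mat n U"
  shows "mat_tr (unitary_diag n U d) = of_real (\<Sum>i<n. d i)"
proof -
  have Uc: "U \<in> carrier_mat n n" using U by (simp add: unitary_mat_def)
  have "mat_tr (unitary_diag n U d) = (\<Sum>i<n. \<Sum>k<n. U $$ (i, k) * of_real (d k) * cnj (U $$ (i, k)))"
    using unitary_diag_carrier[OF Uc, of d] by (auto simp: mat_tr_def unitary_diag_index[OF Uc] intro!: sum.cong)
  also have "\<dots> = (\<Sum>k<n. \<Sum>i<n. of_real (d k) * (cnj (U $$ (i, k)) * U $$ (i, k)))"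
    by (subst sum.swap) (intro sum.cong refl, simp add: mult_ac)
  also have "\<dots> = (\<Sum>k<n. of_real (d k))"
    using unitary_mat_index[OF U] by (intro sum.cong refl) (simp flip: sum_distrib_left)
  finally show ?thesis by simp
qed

text \<open>The eigenvalues are nonnegative because the diagonal entries of \<open>(x U)\<^sup>* (x U)\<close> are the squared
  lengths of the columns of \<open>x U\<close>.\<close>

lemma gram_unitary_diag:
  fixes x :: "complex mat"
  assumes x: "x \<in> carrier_mat n n"
  obtains U d where "unitary_mat n U" "\<And>i. i < n \<Longrightarrow> 0 \<le> d i" "mat_adjoint x * x = unitary_diag n U d"
proof -
  note assoc = assoc_mult_mat[where n\<^sub>1 = n and n\<^sub>2 = n and n\<^sub>3 = n and n\<^sub>4 = n]
    and closed = mult_carrier_mat[where nr = n and n = n and nc = n]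
      right_mult_one_mat[where nr = n and nc = n] left_mult_one_mat[where nr = n and nc = n]
  have G: "mat_adjoint x * x \<in> carrier_mat n n" using x by (simp add: closed)
  have "mat_adjoint (mat_adjoint x * x) = mat_adjoint x * x"
    by (subst mat_adjoint_times[where n = n and m = n and l = n]) (use x in simp_all)
  then obtain U d where U: "unitary_mat n U" and eq: "mat_adjoint x * x = unitary_diag n U d"
    using hermitian_unitary_diag[OF G] by blast
  have Uc: "U \<in> carrier_mat n n" "mat_adjoint U \<in> carrier_mat n n" "mat_adjoint U * U = 1\<^sub>m n"
    using U by (auto simp: unitary_mat_def)
  let ?D = "mat_diag n (\<lambda>i. complex_of_real (d i))"
  have "mat_adjoint (x * U) * (x * U) = mat_adjoint U * (mat_adjoint x * x) * U"
    using x Uc(1,2) by (simp add: mat_adjoint_times[OF x Uc(1)] assoc closed)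
  also have "\<dots> = (mat_adjoint U * U) * ?D * (mat_adjoint U * U)"
    unfolding eq unitary_diag_def using Uc(1,2) by (simp add: assoc closed)
  also have "\<dots> = ?D" using Uc by (simp add: closed)
  finally have D: "mat_adjoint (x * U) * (x * U) = ?D" .
  have "0 \<le> d i" if i: "i < n" for i
  proof -
    have y: "x * U \<in> carrier_mat n n" using x Uc by (simp add: closed)
    have "complex_of_real (d i) = (mat_adjoint (x * U) * (x * U)) $$ (i, i)"
      unfolding D using i by (simp add: mat_diag_def)
    also have "\<dots> = (\<Sum>k<n. mat_adjoint (x * U) $$ (i, k) * (x * U) $$ (k, i))"
      by (rule times_mat_index[OF _ y i i]) (use y in \<open>rule mat_adjoint_carrier\<close>)
    also have "\<dots> = (\<Sum>k<n. of_real ((cmod ((x * U) $$ (k, i)))\<^sup>2))"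
      using x Uc i by (intro sum.cong refl) (simp add: mat_adjoint_index complex_norm_square[symmetric] mult.commute del: index_mult_mat(1))
    also have "\<dots> = complex_of_real (\<Sum>k<n. (cmod ((x * U) $$ (k, i)))\<^sup>2)" by simp
    finally have "d i = (\<Sum>k<n. (cmod ((x * U) $$ (k, i)))\<^sup>2)" by (simp only: of_real_eq_iff)
    thus ?thesis by (simp add: sum_nonneg)
  qed
  with that U eq show ?thesis by blast
qed

lemma tr_abs_powr_eq_sum:
  assumes "unitary_mat n U" "mat_adjoint x * x = unitary_diag n U d"
  shows "tr_abs_powr p x = (\<Sum>i<n. sqrt (d i) powr p)"
  using assms by (simp add: tr_abs_powr_def mat_abs_def hermitian_fun_unitary_diag mat_tr_unitary_diag)

lemma tr_abs_powr_nonneg: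
  assumes "x \<in> carrier_mat n n"
  shows "0 \<le> tr_abs_powr p x"
  using gram_unitary_diag[OF assms] tr_abs_powr_eq_sum by (metis sum_nonneg powr_ge_zero)

lemma tr_abs_powr_smult:
  assumes x: "x \<in> carrier_mat n n"
  shows "tr_abs_powr p (c \<cdot>\<^sub>m x) = cmod c powr p * tr_abs_powr p x"
proof -
  obtain U d where U: "unitary_mat n U" and d: "\<And>i. i < n \<Longrightarrow> 0 \<le> d i"
    and eq: "mat_adjoint x * x = unitary_diag n U d"
    using gram_unitary_diag[OF x] by blast
  have Uc: "U \<in> carrier_mat n n" using U by (simp add: unitary_mat_def)
  have c2: "cnj c * c = of_real ((cmod c)\<^sup>2)" by (simp add: complex_norm_square[symmetric] mult.commute)
  have "mat_adjoint (c \<cdot>\<^sub>m x) * (c \<cdot>\<^sub>m x) = (cnj c * c) \<cdot>\<^sub>m (mat_adjoint x * x)"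
    using x by (intro eq_matI) (auto simp: mat_adjoint_smult mult_smult_assoc_mat[where nr = n and n = n and nc = n]
      mult_smult_distrib[where nr = n and n = n and nc = n] mult_ac simp del: index_mult_mat(1))
  also have "\<dots> = unitary_diag n U (\<lambda>i. (cmod c)\<^sup>2 * d i)"
    unfolding eq c2 using carrier_matD[OF unitary_diag_carrier[OF Uc]]
    by (intro eq_matI) (auto simp: unitary_diag_index[OF Uc] sum_distrib_left mult_ac)
  finally have "tr_abs_powr p (c \<cdot>\<^sub>m x) = (\<Sum>i<n. sqrt ((cmod c)\<^sup>2 * d i) powr p)"
    using tr_abs_powr_eq_sum[OF U] by blast
  also have "\<dots> = cmod c powr p * tr_abs_powr p x"
    unfolding tr_abs_powr_eq_sum[OF U eq] sum_distrib_left
    by (intro sum.cong refl) (simp add: real_sqrt_mult powr_mult d)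
  finally show ?thesis .
qed

lemma tr_abs_powr_eq_0_imp:
  assumes x: "x \<in> carrier_mat n n" and 0: "tr_abs_powr p x = 0"
  shows "x = 0\<^sub>m n n"
proof -
  obtain U d where U: "unitary_mat n U" and d: "\<And>i. i < n \<Longrightarrow> 0 \<le> d i"
    and eq: "mat_adjoint x * x = unitary_diag n U d"
    using gram_unitary_diag[OF x] by blast
  have Uc: "U \<in> carrier_mat n n" using U by (simp add: unitary_mat_def)
  have "\<forall>i\<in>{..<n}. sqrt (d i) powr p = 0"
    using 0 unfolding tr_abs_powr_eq_sum[OF U eq] by (subst (asm) sum_nonneg_eq_0_iff) auto
  hence d0: "d i = 0" if "i < n" for i using that d by auto
  show ?thesis
  proof (rule eq_matI)
    fix i j assume "i < dim_row (0\<^sub>m n n :: complex mat)" "j < dim_col (0\<^sub>m n n :: complex mat)"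
    hence ij: "i < n" "j < n" by auto
    have "(\<Sum>k<n. of_real ((cmod (x $$ (k, j)))\<^sup>2)) = (\<Sum>k<n. mat_adjoint x $$ (j, k) * x $$ (k, j))"
      using x ij by (intro sum.cong refl) (simp add: mat_adjoint_index complex_norm_square[symmetric] mult.commute)
    also have "\<dots> = (mat_adjoint x * x) $$ (j, j)"
      by (rule times_mat_index[symmetric]) (use x ij in auto)
    also have "\<dots> = 0" unfolding eq unitary_diag_index[OF Uc ij(2) ij(2)] by (simp add: d0)
    finally have "complex_of_real (\<Sum>k<n. (cmod (x $$ (k, j)))\<^sup>2) = 0" by simp
    hence "(\<Sum>k<n. (cmod (x $$ (k, j)))\<^sup>2) = 0" by (simp only: of_real_eq_0_iff)
    hence "\<forall>k\<in>{..<n}. (cmod (x $$ (k, j)))\<^sup>2 = 0" by (subst (asm) sum_nonneg_eq_0_iff) auto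
    thus "x $$ (i, j) = 0\<^sub>m n n $$ (i, j)" using ij by auto
  qed (use x in auto)
qed

lemma tr_abs_powr_zero: "tr_abs_powr p (0\<^sub>m n n) = 0"
proof -
  have "(0\<^sub>m n n :: complex mat) = 0 \<cdot>\<^sub>m 0\<^sub>m n n" by (intro eq_matI) auto
  thus ?thesis using tr_abs_powr_smult[of "0\<^sub>m n n" n p 0] by simp
qed

lemma tr_abs_powr_unitary_times:
  assumes u: "unitary_mat n u" and x: "x \<in> carrier_mat n n"
  shows "tr_abs_powr p (u * x) = tr_abs_powr p x"
proof -
  have uc: "u \<in> carrier_mat n n" "mat_adjoint u \<in> carrier_mat n n" "mat_adjoint u * u = 1\<^sub>m n"
    using u by (auto simp: unitary_mat_def)
  note assoc = assoc_mult_mat[where n\<^sub>1 = n and n\<^sub>2 = n and n\<^sub>3 = n and n\<^sub>4 = n]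
    and closed = mult_carrier_mat[where nr = n and n = n and nc = n]
      right_mult_one_mat[where nr = n and nc = n] left_mult_one_mat[where nr = n and nc = n]
  have "mat_adjoint (u * x) * (u * x) = mat_adjoint x * (mat_adjoint u * u) * x"
    using x uc(1,2) by (simp add: mat_adjoint_times[OF uc(1) x] assoc closed)
  also have "\<dots> = mat_adjoint x * x" using x uc(3) by simp
  finally show ?thesis by (simp add: tr_abs_powr_def mat_abs_def)
qed

section \<open>Splittings of the plane with an \<open>l\<^sub>p\<close> norm\<close>

text \<open>Concavity of \<open>y \<mapsto> y\<^sup>q\<close>, as the weighted mean inequality for \<open>y\<close> and \<open>1\<close>. The convex case
  below is the same inequality for the inverse function.\<close>

lemma powr_le_tangent:
  fixes y q :: real
  assumes "0 \<le> y" "0 < q" "q \<le> 1"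
  shows "y powr q \<le> 1 + q * (y - 1)"
proof (cases "y = 0")
  case False
  thus ?thesis
    using Youngs_inequality_0[of q "1 - q" y 1] assms by (simp add: algebra_simps)
qed (use assms in simp)

lemma powr_ge_tangent:
  fixes y q :: real
  assumes "0 \<le> y" "1 \<le> q"
  shows "1 + q * (y - 1) \<le> y powr q"
proof -
  have "(y powr q) powr (1 / q) \<le> 1 + (1 / q) * (y powr q - 1)"
    using assms by (intro powr_le_tangent) auto
  also have "(y powr q) powr (1 / q) = y" using assms by (simp add: powr_powr)
  finally have "q * (y - 1) \<le> q * ((1 / q) * (y powr q - 1))"
    using assms by (intro mult_left_mono) auto
  thus ?thesis using assms by simp
qed

lemma parallelogram_cmod:
  "(cmod (1 + z))\<^sup>2 + (cmod (1 - z))\<^sup>2 = 2 + 2 * (cmod z)\<^sup>2"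
  unfolding cmod_power2 by (simp add: power2_eq_square algebra_simps)

lemma cmod_powr_half: "cmod z powr p = ((cmod z)\<^sup>2) powr (p / 2)"
  by (simp add: powr_powr flip: powr_numeral)

text \<open>The tangent inequality for the exponent \<open>p/2\<close> at \<open>|1 \<plusminus> z|\<^sup>2\<close>. The linear terms are summed by
  the parallelogram law, so only the second order in \<open>z\<close> remains.\<close>

lemma cmod_powr_parallelogram_le:
  assumes "0 < p" "p \<le> 2"
  shows "cmod (1 + z) powr p + cmod (1 - z) powr p \<le> 2 + p * (cmod z)\<^sup>2"
proof -
  have "cmod (1 + z) powr p + cmod (1 - z) powr p
      \<le> (1 + p / 2 * ((cmod (1 + z))\<^sup>2 - 1)) + (1 + p / 2 * ((cmod (1 - z))\<^sup>2 - 1))"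
    unfolding cmod_powr_half[of _ p] using assms by (intro add_mono powr_le_tangent) auto
  also have "\<dots> = 2 + p / 2 * ((cmod (1 + z))\<^sup>2 + (cmod (1 - z))\<^sup>2 - 2)" by (simp add: algebra_simps)
  also have "\<dots> = 2 + p * (cmod z)\<^sup>2" unfolding parallelogram_cmod by simp
  finally show ?thesis .
qed

lemma cmod_powr_parallelogram_ge:
  assumes "2 \<le> p"
  shows "2 + p * (cmod z)\<^sup>2 \<le> cmod (1 + z) powr p + cmod (1 - z) powr p"
proof -
  have "2 + p * (cmod z)\<^sup>2 = 2 + p / 2 * ((cmod (1 + z))\<^sup>2 + (cmod (1 - z))\<^sup>2 - 2)"
    unfolding parallelogram_cmod by simp
  also have "\<dots> = (1 + p / 2 * ((cmod (1 + z))\<^sup>2 - 1)) + (1 + p / 2 * ((cmod (1 - z))\<^sup>2 - 1))"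
    by (simp add: algebra_simps)
  also have "\<dots> \<le> cmod (1 + z) powr p + cmod (1 - z) powr p"
    unfolding cmod_powr_half[of _ p] using assms by (intro add_mono powr_ge_tangent) auto
  finally show ?thesis .
qed

text \<open>Let \<open>t\<close> tend to \<open>0\<close>; the proof takes a \<open>t\<close> for which the right side is at most \<open>m / 2\<close>.\<close>

lemma nonpos_if_powr_dominated:
  fixes r m d :: real
  assumes "0 < r" and le: "\<And>t. 0 < t \<Longrightarrow> m \<le> t powr r * d"
  shows "m \<le> 0"
proof (rule ccontr)
  assume "\<not> m \<le> 0"
  define q where "q = m / (2 * (\<bar>d\<bar> + m))"
  define t where "t = q powr (1 / r)"
  have pos: "0 < q" using \<open>\<not> m \<le> 0\<close> by (simp add: q_def)
  hence "0 < t" by (simp add: t_def)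
  moreover have "t powr r = q"
    using pos \<open>0 < r\<close> by (simp add: t_def powr_powr)
  ultimately have "m \<le> q * d" using le[of t] by simp
  also have "\<dots> \<le> q * (\<bar>d\<bar> + m)"
    using \<open>\<not> m \<le> 0\<close> pos by (intro mult_left_mono) auto
  also have "\<dots> = m / 2" using \<open>\<not> m \<le> 0\<close> by (simp add: q_def field_simps)
  finally show False using \<open>\<not> m \<le> 0\<close> by simp
qed

text \<open>The left side is the \<open>p\<close>-th power of the norm of the plane \<open>l\<^sub>p\<^sup>2\<close> with weights \<open>A\<close>, \<open>B\<close>; the right side would
  split the same plane along the vector \<open>(1, 1)\<close> and a complementary one. Moving from \<open>(1, 1)\<close> by \<open>t\<close> in the complementary direction
  \<open>(c, c - 1)\<close> changes the right side by exactly \<open>|t|\<^sup>p D\<close>, while the average of the left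
  side over \<open>\<plusminus>t\<close> changes in the order \<open>t\<^sup>2\<close>. For \<open>p > 2\<close> the left side grows at least
  like \<open>p M t\<^sup>2 / 2\<close>, too fast for small \<open>t\<close>. For \<open>p < 2\<close> it grows at most like this, which forces \<open>D = 0\<close>; then
  the complementary direction has norm \<open>0\<close>, but it is not the zero vector.\<close>

lemma l2p_no_transversal_splitting:
  fixes A B D V p :: real and c :: complex
  assumes p: "1 \<le> p" "p \<noteq> 2" and nonneg: "0 \<le> A" "0 \<le> B" "0 \<le> D"
    and eq: "\<And>\<alpha> \<beta>. cmod \<alpha> powr p * A + cmod \<beta> powr p * B =
      cmod (\<alpha> + (\<beta> - \<alpha>) * c) powr p * V + cmod (\<beta> - \<alpha>) powr p * D"
  shows "A = 0 \<or> B = 0"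
proof (rule ccontr)
  assume "\<not> (A = 0 \<or> B = 0)"
  hence AB: "0 < A" "0 < B" using nonneg by auto
  have V: "V = A + B" using eq[of 1 1] by simp
  define M where "M = A * (cmod c)\<^sup>2 + B * (cmod (1 - c))\<^sup>2"
  have M: "0 < M"
  proof (cases "c = 0")
    case False
    hence "0 < A * (cmod c)\<^sup>2" using AB by simp
    thus ?thesis unfolding M_def using AB by (intro add_pos_nonneg) auto
  qed (use AB in \<open>simp add: M_def\<close>)
  \<comment> \<open>The points \<open>(1, 1) + t (c, c - 1)\<close>; the vector \<open>(c, c - 1)\<close> has no component along \<open>(1, 1)\<close>.\<close>
  have line: "cmod (1 + of_real t * c) powr p * A + cmod (1 - of_real t * (1 - c)) powr p * B =
      V + \<bar>t\<bar> powr p * D" for t :: real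
  proof -
    have "1 + of_real t * c + ((1 - of_real t * (1 - c)) - (1 + of_real t * c)) * c = 1"
      "(1 - of_real t * (1 - c)) - (1 + of_real t * c) = - of_real t"
      by (simp_all add: algebra_simps)
    thus ?thesis using eq[of "1 + of_real t * c" "1 - of_real t * (1 - c)"] by simp
  qed
  define F where "F z = cmod (1 + z) powr p + cmod (1 - z) powr p" for z
  have avg: "F (of_real t * c) * A + F (of_real t * (1 - c)) * B = 2 * (A + B) + 2 * (t powr p * D)"
    if "0 < t" for t
    using line[of t] line[of "- t"] that unfolding F_def V by (simp add: algebra_simps)
  have quad: "(2 + p * (cmod (of_real t * c))\<^sup>2) * A + (2 + p * (cmod (of_real t * (1 - c)))\<^sup>2) * B
      = 2 * (A + B) + t\<^sup>2 * (p * M)" for t :: real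
    unfolding M_def norm_mult by (simp add: algebra_simps power2_eq_square)
  have tp: "t powr p = t powr (p - 2) * t\<^sup>2" "t\<^sup>2 = t powr (2 - p) * t powr p" if "0 < t" for t :: real
    using that by (simp_all flip: powr_add powr_numeral)
  show False
  proof (cases "p < 2")
    case True
    have "D \<le> t powr (2 - p) * (p * M / 2)" if t: "0 < t" for t
    proof -
      have "F (of_real t * c) * A + F (of_real t * (1 - c)) * B \<le> 2 * (A + B) + t\<^sup>2 * (p * M)"
        unfolding quad[symmetric] F_def using p True AB
        by (intro add_mono mult_right_mono cmod_powr_parallelogram_le) auto
      hence "t powr p * D \<le> t powr p * (t powr (2 - p) * (p * M / 2))"
        unfolding avg[OF t] tp(2)[OF t] by (simp add: algebra_simps)
      thus ?thesis using t by simp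
    qed
    hence "D \<le> 0" using nonpos_if_powr_dominated[of "2 - p" D "p * M / 2"] True by simp
    \<comment> \<open>The vector \<open>(c, c - 1)\<close> itself has norm \<open>D = 0\<close>.\<close>
    hence "cmod c powr p * A + cmod (c - 1) powr p * B = 0"
      using eq[of "c" "c - 1"] nonneg p by (simp add: algebra_simps)
    hence "cmod c powr p * A = 0 \<and> cmod (c - 1) powr p * B = 0"
      using AB by (subst (asm) add_nonneg_eq_0_iff) auto
    thus False using AB by auto
  next
    case False
    have "p * M / 2 \<le> t powr (p - 2) * D" if t: "0 < t" for t
    proof -
      have "2 * (A + B) + t\<^sup>2 * (p * M) \<le> F (of_real t * c) * A + F (of_real t * (1 - c)) * B"
        unfolding quad[symmetric] F_def using p False AB
        by (intro add_mono mult_right_mono cmod_powr_parallelogram_ge) auto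
      hence "t\<^sup>2 * (p * M / 2) \<le> t\<^sup>2 * (t powr (p - 2) * D)"
        unfolding avg[OF t] tp(1)[OF t] by (simp add: algebra_simps)
      thus ?thesis using t by simp
    qed
    hence "p * M / 2 \<le> 0" using nonpos_if_powr_dominated[of "p - 2" "p * M / 2" D] False p by simp
    thus False using M p by (simp add: mult_le_0_iff)
  qed
qed

section \<open>Atoms of an \<open>l\<^sub>p\<close>-normed space\<close>

definition linear_isometry :: "'v cnspace \<Rightarrow> ('v \<Rightarrow> 'v) \<Rightarrow> bool" where
  "linear_isometry B U \<longleftrightarrow> U ` carrier B = carrier B \<and> is_linear_on B U \<and>
     (\<forall>x\<in>carrier B. vnorm B (U x) = vnorm B x)"

lemma linear_isometry_if_isometry_group:
  "U \<in> carrier (isometry_group B) \<Longrightarrow> linear_isometry B U"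
  by (auto simp: isometry_group_def linear_isometry_def Bij_def bij_betw_def)

text \<open>The exponent \<open>p\<close> is a parameter of the notions below. The laws of a vector space are required for
  vectors in the carrier, but their sums may leave the carrier: the axioms ask of a norm no more than
  homogeneity and definiteness, which \<open>Tr |x|\<^sup>p\<close> has by the spectral theorem. Every sum whose norm
  is taken below is a sum of orthogonal vectors, and the definition of \<open>p_orth\<close> places these in the carrier.\<close>

locale lp_normed =
  fixes B :: "'v cnspace" and p :: real
  assumes p_ge_1: "1 \<le> p"
    and scale_closed: "x \<in> carrier B \<Longrightarrow> vscale B a x \<in> carrier B"
    and norm_nonneg: "x \<in> carrier B \<Longrightarrow> 0 \<le> vnorm B x"
    and norm_scale: "x \<in> carrier B \<Longrightarrow> vnorm B (vscale B a x) = cmod a * vnorm B x"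
    and norm_0_imp: "x \<in> carrier B \<Longrightarrow> vnorm B x = 0 \<Longrightarrow> x = vscale B 0 x"
    and add_assoc: "x \<in> carrier B \<Longrightarrow> y \<in> carrier B \<Longrightarrow> z \<in> carrier B \<Longrightarrow>
      vplus B (vplus B x y) z = vplus B x (vplus B y z)"
    and add_commute: "x \<in> carrier B \<Longrightarrow> y \<in> carrier B \<Longrightarrow> vplus B x y = vplus B y x"
    and add_zero: "x \<in> carrier B \<Longrightarrow> y \<in> carrier B \<Longrightarrow> vplus B x (vscale B 0 y) = x"
    and scale_add: "x \<in> carrier B \<Longrightarrow> y \<in> carrier B \<Longrightarrow>
      vscale B a (vplus B x y) = vplus B (vscale B a x) (vscale B a y)"
    and add_scale: "x \<in> carrier B \<Longrightarrow> vscale B (a + b) x = vplus B (vscale B a x) (vscale B b x)"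
    and scale_scale: "x \<in> carrier B \<Longrightarrow> vscale B a (vscale B b x) = vscale B (a * b) x"
    and scale_one: "x \<in> carrier B \<Longrightarrow> vscale B 1 x = x"
begin

abbreviation add_B (infixl "+\<^sub>B" 65) where "x +\<^sub>B y \<equiv> vplus B x y"
abbreviation scale_B (infixr "*\<^sub>B" 75) where "a *\<^sub>B x \<equiv> vscale B a x"
abbreviation pnorm :: "'v \<Rightarrow> real" where "pnorm x \<equiv> vnorm B x powr p"

definition p_orth :: "'v \<Rightarrow> 'v \<Rightarrow> bool" where
  "p_orth x y \<longleftrightarrow> x \<in> carrier B \<and> y \<in> carrier B \<and>
     (\<forall>a b. a *\<^sub>B x +\<^sub>B b *\<^sub>B y \<in> carrier B \<and>
       pnorm (a *\<^sub>B x +\<^sub>B b *\<^sub>B y) = cmod a powr p * pnorm x + cmod b powr p * pnorm y)"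

text \<open>An atom spans a one-dimensional \<open>l\<^sub>p\<close>-summand.\<close>

definition p_atom :: "'v \<Rightarrow> bool" where
  "p_atom v \<longleftrightarrow> v \<in> carrier B \<and> vnorm B v \<noteq> 0 \<and>
     (\<forall>y\<in>carrier B. \<exists>c y'. y = c *\<^sub>B v +\<^sub>B y' \<and> p_orth v y')"

definition p_divisible :: "'v \<Rightarrow> bool" where
  "p_divisible x \<longleftrightarrow> (\<exists>y z. x = y +\<^sub>B z \<and> p_orth y z \<and> vnorm B y \<noteq> 0 \<and> vnorm B z \<noteq> 0)"

lemma p_orthD:
  assumes "p_orth x y"
  shows "x \<in> carrier B" "y \<in> carrier B" "a *\<^sub>B x +\<^sub>B b *\<^sub>B y \<in> carrier B"
    "pnorm (a *\<^sub>B x +\<^sub>B b *\<^sub>B y) = cmod a powr p * pnorm x + cmod b powr p * pnorm y"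
  using assms unfolding p_orth_def by auto

lemma zero_unique: "x \<in> carrier B \<Longrightarrow> y \<in> carrier B \<Longrightarrow> 0 *\<^sub>B x = 0 *\<^sub>B y"
  by (metis add_commute add_zero scale_closed)

lemma zero_add: "x \<in> carrier B \<Longrightarrow> y \<in> carrier B \<Longrightarrow> 0 *\<^sub>B y +\<^sub>B x = x"
  by (metis add_commute add_zero scale_closed)

lemma norm_zero: "x \<in> carrier B \<Longrightarrow> vnorm B (0 *\<^sub>B x) = 0"
  by (simp add: norm_scale)

lemma pnorm_scale: "x \<in> carrier B \<Longrightarrow> pnorm (a *\<^sub>B x) = cmod a powr p * pnorm x"
  by (simp add: norm_scale powr_mult norm_nonneg)

lemma p_orth_scale:
  assumes "p_orth x y"
  shows "p_orth (c *\<^sub>B x) y"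
  using p_orthD[OF assms]
  by (simp add: p_orth_def scale_closed scale_scale pnorm_scale norm_mult powr_mult)

lemma p_orth_linear_isometry:
  assumes U: "linear_isometry B U" and xy: "p_orth x y"
  shows "p_orth (U x) (U y)"
proof -
  have closed: "U z \<in> carrier B" if "z \<in> carrier B" for z
    using U that by (auto simp: linear_isometry_def)
  have norm: "vnorm B (U z) = vnorm B z" if "z \<in> carrier B" for z
    using U that by (auto simp: linear_isometry_def)
  have lin: "a *\<^sub>B U x +\<^sub>B b *\<^sub>B U y = U (a *\<^sub>B x +\<^sub>B b *\<^sub>B y)" for a b
    using U p_orthD[OF xy] scale_closed by (simp add: linear_isometry_def is_linear_on_def)
  show ?thesis using p_orthD[OF xy] by (simp add: p_orth_def lin closed norm)
qed

lemma p_atom_linear_isometry: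
  assumes U: "linear_isometry B U" and v: "p_atom v"
  shows "p_atom (U v)"
  unfolding p_atom_def
proof (intro conjI ballI)
  show "U v \<in> carrier B" "vnorm B (U v) \<noteq> 0"
    using U v by (auto simp: linear_isometry_def p_atom_def)
  fix y assume "y \<in> carrier B"
  then obtain z where z: "z \<in> carrier B" "y = U z" using U by (auto simp: linear_isometry_def)
  obtain c z' where z': "z = c *\<^sub>B v +\<^sub>B z'" "p_orth v z'" using v z by (auto simp: p_atom_def)
  have "y = c *\<^sub>B U v +\<^sub>B U z'"
    using U z z' p_orthD[OF z'(2)] scale_closed by (simp add: linear_isometry_def is_linear_on_def)
  thus "\<exists>c y'. y = c *\<^sub>B U v +\<^sub>B y' \<and> p_orth (U v) y'"
    using p_orth_linear_isometry[OF U z'(2)] by blast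
qed

text \<open>If \<open>v = a + b\<close> is an orthogonal splitting and \<open>b = c v + b'\<close> is the splitting of \<open>b\<close> along the atom \<open>v\<close>, then
  also \<open>a = (1 - c) v - b'\<close>. So the plane spanned by \<open>a\<close> and \<open>b\<close> is an \<open>l\<^sub>p\<close>-sum in two
  transversal ways.\<close>

lemma p_atom_not_divisible:
  assumes p2: "p \<noteq> 2" and v: "p_atom v"
  shows "\<not> p_divisible v"
proof
  assume "p_divisible v"
  then obtain a b where v_eq: "v = a +\<^sub>B b" and ab: "p_orth a b"
    and nz: "vnorm B a \<noteq> 0" "vnorm B b \<noteq> 0"
    unfolding p_divisible_def by blast
  note [simp] = p_orthD(1,2)[OF ab] scale_closed
  have v_in: "v \<in> carrier B" using v by (simp add: p_atom_def)
  obtain c b' where b_eq: "b = c *\<^sub>B v +\<^sub>B b'" and vb': "p_orth v b'"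
    using v p_orthD(2)[OF ab] unfolding p_atom_def by blast
  have b': "b' \<in> carrier B" using p_orthD(2)[OF vb'] .
  have a_eq: "a = v +\<^sub>B (-1) *\<^sub>B b"
  proof -
    have "v +\<^sub>B (-1) *\<^sub>B b = a +\<^sub>B (1 *\<^sub>B b +\<^sub>B (-1) *\<^sub>B b)"
      by (simp add: v_eq add_assoc scale_one)
    also have "1 *\<^sub>B b +\<^sub>B (-1) *\<^sub>B b = 0 *\<^sub>B b" using add_scale[of b 1 "-1"] by simp
    finally show ?thesis by (simp add: add_zero)
  qed
  have comb: "\<alpha> *\<^sub>B a +\<^sub>B \<beta> *\<^sub>B b = (\<alpha> + (\<beta> - \<alpha>) * c) *\<^sub>B v +\<^sub>B (\<beta> - \<alpha>) *\<^sub>B b'" for \<alpha> \<beta>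
  proof -
    have "\<alpha> *\<^sub>B a +\<^sub>B \<beta> *\<^sub>B b = (\<alpha> *\<^sub>B v +\<^sub>B (- \<alpha>) *\<^sub>B b) +\<^sub>B \<beta> *\<^sub>B b"
      by (subst a_eq) (simp add: scale_add scale_scale v_in)
    also have "\<dots> = \<alpha> *\<^sub>B v +\<^sub>B ((- \<alpha>) + \<beta>) *\<^sub>B b"
      by (simp only: add_scale add_assoc scale_closed v_in p_orthD(2)[OF ab])
    also have "\<dots> = \<alpha> *\<^sub>B v +\<^sub>B (\<beta> - \<alpha>) *\<^sub>B (c *\<^sub>B v +\<^sub>B b')" by (simp flip: b_eq)
    also have "\<dots> = \<alpha> *\<^sub>B v +\<^sub>B (((\<beta> - \<alpha>) * c) *\<^sub>B v +\<^sub>B (\<beta> - \<alpha>) *\<^sub>B b')"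
      by (simp only: scale_add scale_scale scale_closed v_in b')
    also have "\<dots> = (\<alpha> + (\<beta> - \<alpha>) * c) *\<^sub>B v +\<^sub>B (\<beta> - \<alpha>) *\<^sub>B b'"
      by (simp only: add_scale add_assoc[symmetric] scale_closed v_in b')
    finally show ?thesis .
  qed
  have "pnorm a = 0 \<or> pnorm b = 0"
  proof (rule l2p_no_transversal_splitting[OF p_ge_1 p2, where c = c and V = "pnorm v" and D = "pnorm b'"])
    show "cmod \<alpha> powr p * pnorm a + cmod \<beta> powr p * pnorm b =
      cmod (\<alpha> + (\<beta> - \<alpha>) * c) powr p * pnorm v + cmod (\<beta> - \<alpha>) powr p * pnorm b'" for \<alpha> \<beta>
      using p_orthD(4)[OF ab, of \<alpha> \<beta>] p_orthD(4)[OF vb', of "\<alpha> + (\<beta> - \<alpha>) * c" "\<beta> - \<alpha>"]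
      unfolding comb by linarith
  qed auto
  thus False using nz by simp
qed

text \<open>The splitting \<open>w = c v + w'\<close> along \<open>v\<close> is orthogonal, so one of its parts vanishes.\<close>

lemma p_atoms_parallel_or_orth:
  assumes p2: "p \<noteq> 2" and v: "p_atom v" and w: "p_atom w"
  shows "(\<exists>c. w = c *\<^sub>B v) \<or> p_orth v w"
proof -
  have vw: "v \<in> carrier B" "w \<in> carrier B" "vnorm B v \<noteq> 0" using v w by (auto simp: p_atom_def)
  obtain c w' where w_eq: "w = c *\<^sub>B v +\<^sub>B w'" and vw': "p_orth v w'"
    using v vw unfolding p_atom_def by blast
  have w': "w' \<in> carrier B" using p_orthD(2)[OF vw'] .
  from p_atom_not_divisible[OF p2 w] p_orth_scale[OF vw', of c]
  consider "vnorm B (c *\<^sub>B v) = 0" | "vnorm B w' = 0"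
    unfolding p_divisible_def using w_eq by blast
  thus ?thesis
  proof cases
    case 1
    hence "c = 0" using vw by (simp add: norm_scale)
    hence "w = w'" using w_eq vw w' by (simp add: zero_add)
    thus ?thesis using vw' by simp
  next
    case 2
    hence "w' = 0 *\<^sub>B w'" using norm_0_imp w' by blast
    hence "w = c *\<^sub>B v" using w_eq vw w' by (metis add_zero scale_closed)
    thus ?thesis by blast
  qed
qed

text \<open>By orthogonality the \<open>p\<close>-th power of the norm is multiplied by \<open>2 (1/\<surd>2)\<^sup>p = 2\<^bsup>1 - p/2\<^esup>\<close>.\<close>

lemma p_orth_rotation_norm_neq:
  assumes p2: "p \<noteq> 2" and vw: "p_orth v w" and norm: "vnorm B w = vnorm B v" "vnorm B v \<noteq> 0"
  shows "vnorm B (complex_of_real (1 / sqrt 2) *\<^sub>B v +\<^sub>B (complex_of_real (1 / sqrt 2) * \<i>) *\<^sub>B w) \<noteq> vnorm B v"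
proof
  define s where "s = 1 / sqrt (2 :: real)"
  assume "vnorm B (complex_of_real (1 / sqrt 2) *\<^sub>B v +\<^sub>B (complex_of_real (1 / sqrt 2) * \<i>) *\<^sub>B w) = vnorm B v"
  hence "pnorm v = cmod (complex_of_real s) powr p * pnorm v + cmod (complex_of_real s * \<i>) powr p * pnorm v"
    using p_orthD(4)[OF vw, of "complex_of_real s" "complex_of_real s * \<i>"]
    unfolding norm(1) s_def[symmetric] by simp
  moreover have "cmod (complex_of_real s) = s" "cmod (complex_of_real s * \<i>) = s"
    by (simp_all add: norm_mult norm_divide s_def)
  ultimately have "pnorm v * (2 * s powr p) = pnorm v * 1" by simp
  hence "2 * s powr p = 1" using norm(2) unfolding mult_cancel_left by simp
  moreover have "s = 2 powr (- (1 / 2))"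
    by (simp add: s_def powr_minus powr_half_sqrt field_simps)
  hence "2 * s powr p = 2 powr 1 * 2 powr (- (1 / 2) * p)" by (simp only: powr_powr) simp
  hence "2 * s powr p = 2 powr (1 - p / 2)" by (simp only: powr_add[symmetric]) simp
  ultimately have "2 powr (1 - p / 2) = (1 :: real)" by simp
  thus False using p2 by (simp add: powr_eq_one_iff_gen)
qed

text \<open>An isometry acts on an invariant line by a scalar of modulus \<open>1\<close>, so the coefficient
  \<open>g \<mapsto> \<phi> (\<pi> g e)\<close> has constant modulus \<open>|\<phi> e|\<close>. The compact set outside of which it is smaller than
  \<open>|\<phi> e|\<close> is then the whole group.\<close>

lemma compact_if_vanishing_coefficients:
  assumes rep: "orthogonal_rep G T B \<pi>" and van: "vanishing_coefficients T B \<pi>"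
    and top: "topspace T = carrier G"
    and e: "e \<in> carrier B" "\<phi> \<in> dual_space B" "\<phi> e \<noteq> 0"
    and line: "\<And>U. linear_isometry B U \<Longrightarrow> \<exists>c. U e = c *\<^sub>B e"
  shows "compact_space T"
proof -
  have phi_scale: "\<phi> (c *\<^sub>B e) = c * \<phi> e" for c using e by (auto simp: dual_space_def)
  have ne: "vnorm B e \<noteq> 0"
  proof
    assume "vnorm B e = 0"
    hence "\<phi> e = 0 * \<phi> e" using norm_0_imp[OF e(1)] phi_scale[of 0] by simp
    thus False using e by simp
  qed
  have coeff: "cmod (\<phi> (\<pi> g e)) = cmod (\<phi> e)" if g: "g \<in> carrier G" for g
  proof -
    have "\<pi> g \<in> carrier (isometry_group B)" using rep g by (auto simp: orthogonal_rep_def hom_def)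
    hence iso: "linear_isometry B (\<pi> g)" by (rule linear_isometry_if_isometry_group)
    then obtain c where c: "\<pi> g e = c *\<^sub>B e" using line by blast
    have "cmod c * vnorm B e = vnorm B e"
      using iso e(1) norm_scale[OF e(1), of c] unfolding linear_isometry_def c[symmetric] by simp
    hence "cmod c = 1" using ne by simp
    thus ?thesis by (simp add: c phi_scale norm_mult)
  qed
  obtain K where K: "compactin T K" "\<And>g. g \<in> topspace T - K \<Longrightarrow> cmod (\<phi> (\<pi> g e)) < cmod (\<phi> e)"
    using van e unfolding vanishing_coefficients_def by (metis zero_less_norm_iff)
  have "topspace T \<subseteq> K" using K(2) coeff unfolding top by fastforce
  hence "K = topspace T" using compactin_subset_topspace[OF K(1)] by blast
  thus ?thesis using K(1) by (simp add: compact_space_def)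
qed

end

section \<open>Functions on the unit interval are divisible\<close>

lemma ae_eq_self: "ae_eq f f \<longleftrightarrow> f \<in> borel_measurable (lebesgue_on {0..1})"
  by (simp add: ae_eq_def)

lemma ae_fun_cases:
  obtains f where "F = abs_ae_fun f" "f \<in> borel_measurable (lebesgue_on {0..1})"
proof -
  have "F = abs_ae_fun (rep_ae_fun F)" by (simp add: Quotient3_abs_rep[OF Quotient3_ae_fun])
  moreover have "ae_eq (rep_ae_fun F) (rep_ae_fun F)" by (rule Quotient3_rep_reflp[OF Quotient3_ae_fun])
  ultimately show ?thesis using that ae_eq_self by blast
qed

lemma ae_plus_assoc: "ae_plus (ae_plus x y) z = ae_plus x (ae_plus y z)"
  by transfer (simp add: ae_eq_def add.assoc)

lemma ae_plus_commute: "ae_plus x y = ae_plus y x"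
  by transfer (simp add: ae_eq_def add.commute)

lemma ae_plus_zero: "ae_plus x (ae_scale 0 y) = x"
  by transfer (simp add: ae_eq_def)

lemma ae_scale_plus: "ae_scale a (ae_plus x y) = ae_plus (ae_scale a x) (ae_scale a y)"
  by transfer (simp add: ae_eq_def algebra_simps)

lemma ae_plus_scale: "ae_scale (a + b) x = ae_plus (ae_scale a x) (ae_scale b x)"
  by transfer (simp add: ae_eq_def algebra_simps)

lemma ae_scale_scale: "ae_scale a (ae_scale b x) = ae_scale (a * b) x"
  by transfer (simp add: ae_eq_def mult.assoc)

lemma ae_scale_one: "ae_scale 1 x = x"
  by transfer (simp add: ae_eq_def)

definition p_integral :: "real \<Rightarrow> (real \<Rightarrow> complex) \<Rightarrow> real" where
  "p_integral p f = (LINT t|lebesgue_on {0..1}. cmod (f t) powr p)"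

lemma p_integral_nonneg: "0 \<le> p_integral p f"
  unfolding p_integral_def by (rule integral_nonneg_AE) simp

lemma Lp_space_lp_normed:
  assumes p: "1 \<le> p"
  shows "lp_normed (Lp_space p) p"
proof
  show "vscale (Lp_space p) a x \<in> carrier (Lp_space p)" if "x \<in> carrier (Lp_space p)" for a x
    using that unfolding Lp_space_def by simp (transfer, simp add: norm_mult powr_mult)
  show "0 \<le> vnorm (Lp_space p) x" for x
    unfolding Lp_space_def by simp (transfer, simp)
  show "vnorm (Lp_space p) (vscale (Lp_space p) a x) = cmod a * vnorm (Lp_space p) x" for a x
    unfolding Lp_space_def using p
    by simp (transfer, simp add: norm_mult powr_mult powr_powr integral_nonneg_AE)
  show "x = vscale (Lp_space p) 0 x" if "x \<in> carrier (Lp_space p)" "vnorm (Lp_space p) x = 0" for x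
    using that unfolding Lp_space_def
    by simp (transfer, auto simp: ae_eq_def integral_nonneg_eq_0_iff_AE elim: eventually_mono)
qed (use p in \<open>auto simp: Lp_space_def ae_plus_assoc ae_plus_zero ae_scale_plus ae_plus_scale
  ae_scale_scale ae_scale_one intro: ae_plus_commute\<close>)

lemma pred_le_lebesgue_on [measurable]:
  fixes s :: real
  shows "Measurable.pred (lebesgue_on {0..1}) (\<lambda>t. t \<le> s)"
proof -
  have "{t \<in> space (lebesgue_on {0..1}). t \<le> s} = {0..1} \<inter> {..s}" by auto
  thus ?thesis unfolding pred_def by (auto simp: sets_restrict_space)
qed

text \<open>Lebesgue measure has no atoms: the integral over \<open>[0, s]\<close> is continuous in \<open>s\<close> and takes
  every value between \<open>0\<close> and the integral over \<open>[0, 1]\<close>.\<close>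

lemma split_integral_in_half:
  fixes h :: "real \<Rightarrow> real"
  assumes h: "integrable (lebesgue_on {0..1}) h"
  obtains s where "(LINT t|lebesgue_on {0..1}. (if t \<le> s then h t else 0)) =
    (LINT t|lebesgue_on {0..1}. h t) / 2"
proof -
  define J where "J s = integral {0..s} h" for s
  have h_on: "h integrable_on {0..1}" by (rule integrable_on_lebesgue_on[OF h]) simp
  have total: "J 1 = (LINT t|lebesgue_on {0..1}. h t)"
    unfolding J_def by (rule lebesgue_integral_eq_integral[OF h, symmetric]) simp
  have "continuous_on {0..1} J"
    unfolding J_def by (rule indefinite_integral_continuous_1[OF h_on])
  moreover have "J 0 = 0" by (simp add: J_def)
  ultimately obtain s where s: "0 \<le> s" "s \<le> 1" "J s = J 1 / 2"
    using IVT'[of J 0 "J 1 / 2" 1] IVT2'[of J 1 "J 1 / 2" 0] by (cases "0 \<le> J 1") auto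
  have [measurable]: "h \<in> borel_measurable (lebesgue_on {0..1})" using h by auto
  have "integrable (lebesgue_on {0..1}) (\<lambda>t. if t \<in> {..s} then h t else 0)"
    by (rule Bochner_Integration.integrable_bound[OF h]) auto
  hence "(LINT t|lebesgue_on {0..1}. (if t \<in> {..s} then h t else 0)) =
      integral {0..1} (\<lambda>t. if t \<in> {..s} then h t else 0)"
    by (rule lebesgue_integral_eq_integral) simp
  also have "\<dots> = J s"
    unfolding J_def Henstock_Kurzweil_Integration.integral_restrict_Int
    using s by (intro arg_cong[where f = "\<lambda>S. integral S h"]) auto
  finally show ?thesis using that s(3) total by simp
qed

text \<open>Cut at a point where the integral of \<open>|f|\<^sup>p\<close> is split in half.\<close>

lemma Lp_p_divisible:
  assumes p: "1 \<le> p" and F: "F \<in> carrier (Lp_space p)" "vnorm (Lp_space p) F \<noteq> 0"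
  shows "lp_normed.p_divisible (Lp_space p) p F"
proof -
  interpret lp_normed "Lp_space p" p by (rule Lp_space_lp_normed[OF p])
  let ?R = "lebesgue_on {0..1 :: real}"
  obtain f where F_eq: "F = abs_ae_fun f" and f [measurable]: "f \<in> borel_measurable ?R"
    by (rule ae_fun_cases)
  have int: "integrable ?R (\<lambda>t. cmod (f t) powr p)"
    using F f by (simp add: F_eq Lp_space_def Lp_member.abs_eq ae_eq_self)
  obtain s where s: "(LINT t|?R. (if t \<le> s then cmod (f t) powr p else 0)) = p_integral p f / 2"
    unfolding p_integral_def by (rule split_integral_in_half[OF int])
  define I where "I = p_integral p f"
  \<comment> \<open>The family \<open>g a b\<close> consists of all combinations of the two pieces \<open>g 1 0\<close> and \<open>g 0 1\<close>.\<close>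
  define g where "g a b t = (if t \<le> s then a * f t else b * f t)" for a b t
  have g_meas: "ae_eq (g a b) (g a b)" for a b
    unfolding ae_eq_self g_def by measurable
  let ?h1 = "\<lambda>t. (if t \<le> s then cmod (f t) powr p else 0)"
  let ?h2 = "\<lambda>t. if t \<le> s then 0 else cmod (f t) powr p"
  have int1: "integrable ?R ?h1" and int2: "integrable ?R ?h2"
    by (rule Bochner_Integration.integrable_bound[OF int]; auto)+
  have g_eq: "cmod (g a b t) powr p = cmod a powr p * ?h1 t + cmod b powr p * ?h2 t" for a b t
    by (simp add: g_def norm_mult powr_mult)
  have "(LINT t|?R. ?h1 t + ?h2 t) = I"
    unfolding I_def p_integral_def by (rule Bochner_Integration.integral_cong) auto
  hence half: "(LINT t|?R. ?h1 t) = I / 2" "(LINT t|?R. ?h2 t) = I / 2"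
    using s int1 int2 by (simp_all add: I_def)
  have g_in: "abs_ae_fun (g a b) \<in> carrier (Lp_space p)" for a b
    using int1 int2 by (simp add: Lp_space_def Lp_member.abs_eq g_meas g_eq)
  have g_norm: "vnorm (Lp_space p) (abs_ae_fun (g a b)) powr p = (cmod a powr p + cmod b powr p) * (I / 2)" for a b
  proof -
    have "p_integral p (g a b) = (cmod a powr p + cmod b powr p) * (I / 2)"
    proof -
      have "p_integral p (g a b) = cmod a powr p * (LINT t|?R. ?h1 t) + cmod b powr p * (LINT t|?R. ?h2 t)"
        unfolding p_integral_def g_eq using int1 int2 by simp
      thus ?thesis unfolding half by (simp add: algebra_simps)
    qed
    thus ?thesis
      using p p_integral_nonneg[of p "g a b"]
      by (simp add: Lp_space_def Lp_norm.abs_eq g_meas powr_powr flip: p_integral_def)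
  qed
  have comb: "add_B (scale_B a (abs_ae_fun (g 1 0))) (scale_B b (abs_ae_fun (g 0 1))) = abs_ae_fun (g a b)" for a b
  proof -
    have "ae_eq (\<lambda>t. c * g a b t) (\<lambda>t. c * g a b t)" for a b c
      using g_meas[of a b] by (simp add: ae_eq_self)
    hence "add_B (scale_B a (abs_ae_fun (g 1 0))) (scale_B b (abs_ae_fun (g 0 1))) =
        abs_ae_fun (\<lambda>t. a * g 1 0 t + b * g 0 1 t)"
      by (simp add: Lp_space_def ae_scale.abs_eq ae_plus.abs_eq g_meas)
    also have "(\<lambda>t. a * g 1 0 t + b * g 0 1 t) = g a b" by (auto simp: g_def)
    finally show ?thesis .
  qed
  have "I \<noteq> 0"
    using F(2) f p by (auto simp: F_eq Lp_space_def Lp_norm.abs_eq ae_eq_self I_def p_integral_def)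
  hence "vnorm (Lp_space p) (abs_ae_fun (g 1 0)) \<noteq> 0" "vnorm (Lp_space p) (abs_ae_fun (g 0 1)) \<noteq> 0"
    using g_norm[of 1 0] g_norm[of 0 1] by auto
  moreover have "p_orth (abs_ae_fun (g 1 0)) (abs_ae_fun (g 0 1))"
    unfolding p_orth_def comb using g_in g_norm by (simp add: algebra_simps)
  moreover have "F = add_B (abs_ae_fun (g 1 0)) (abs_ae_fun (g 0 1))"
  proof -
    have "g 1 1 = f" by (auto simp: g_def)
    thus ?thesis using comb[of 1 1] g_in by (simp add: scale_one F_eq)
  qed
  ultimately show ?thesis unfolding p_divisible_def by blast
qed

section \<open>Atoms of an \<open>l\<^sub>p\<close>-direct sum\<close>

locale lp_normed_pair = X: lp_normed X p + Y: lp_normed Y p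
  for X :: "'v cnspace" and Y :: "'w cnspace" and p
begin

lemma sum_simps:
  "carrier (lp_sum p X Y) = carrier X \<times> carrier Y"
  "vplus (lp_sum p X Y) (f, x) (g, y) = (vplus X f g, vplus Y x y)"
  "vscale (lp_sum p X Y) c (f, x) = (vscale X c f, vscale Y c x)"
  "vnorm (lp_sum p X Y) (f, x) powr p = vnorm X f powr p + vnorm Y x powr p"
  using X.p_ge_1 by (simp_all add: lp_sum_def powr_powr)

lemma vnorm_sum: "vnorm (lp_sum p X Y) (f, x) = (vnorm X f powr p + vnorm Y x powr p) powr (1 / p)"
  by (simp add: lp_sum_def)

lemma vnorm_sum_eq_0_iff: "vnorm (lp_sum p X Y) (f, x) = 0 \<longleftrightarrow> vnorm X f = 0 \<and> vnorm Y x = 0"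
  by (simp add: vnorm_sum add_nonneg_eq_0_iff)

sublocale sum: lp_normed "lp_sum p X Y" p
proof
  show "1 \<le> p" by (rule X.p_ge_1)
  fix u assume "u \<in> carrier (lp_sum p X Y)"
  then obtain f x where u: "u = (f, x)" "f \<in> carrier X" "x \<in> carrier Y" by (auto simp: sum_simps)
  show "vscale (lp_sum p X Y) a u \<in> carrier (lp_sum p X Y)" for a
    using u by (simp add: sum_simps X.scale_closed Y.scale_closed)
  show "0 \<le> vnorm (lp_sum p X Y) u" using u by (simp add: vnorm_sum)
  show "vnorm (lp_sum p X Y) (vscale (lp_sum p X Y) a u) = cmod a * vnorm (lp_sum p X Y) u" for a
  proof -
    have "vnorm (lp_sum p X Y) (vscale (lp_sum p X Y) a u) =
        (cmod a powr p * (vnorm X f powr p + vnorm Y x powr p)) powr (1 / p)"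
      using u by (simp add: vnorm_sum sum_simps X.pnorm_scale Y.pnorm_scale distrib_left)
    also have "\<dots> = cmod a * vnorm (lp_sum p X Y) u"
      using u X.p_ge_1 by (simp add: vnorm_sum powr_mult powr_powr)
    finally show ?thesis .
  qed
  show "u = vscale (lp_sum p X Y) 0 u" if "vnorm (lp_sum p X Y) u = 0"
    using that u X.norm_0_imp Y.norm_0_imp by (simp add: sum_simps vnorm_sum_eq_0_iff)
  show "vscale (lp_sum p X Y) (a + b) u = vplus (lp_sum p X Y) (vscale (lp_sum p X Y) a u) (vscale (lp_sum p X Y) b u)" for a b
    using u by (simp add: sum_simps X.add_scale Y.add_scale)
  show "vscale (lp_sum p X Y) a (vscale (lp_sum p X Y) b u) = vscale (lp_sum p X Y) (a * b) u" for a b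
    using u by (simp add: sum_simps X.scale_scale Y.scale_scale)
  show "vscale (lp_sum p X Y) 1 u = u"
    using u by (simp add: sum_simps X.scale_one Y.scale_one)
  fix v assume "v \<in> carrier (lp_sum p X Y)"
  then obtain g y where v: "v = (g, y)" "g \<in> carrier X" "y \<in> carrier Y" by (auto simp: sum_simps)
  show "vplus (lp_sum p X Y) u v = vplus (lp_sum p X Y) v u"
    using u v by (simp add: sum_simps X.add_commute Y.add_commute)
  show "vplus (lp_sum p X Y) u (vscale (lp_sum p X Y) 0 v) = u"
    using u v by (simp add: sum_simps X.add_zero Y.add_zero)
  show "vscale (lp_sum p X Y) a (vplus (lp_sum p X Y) u v) =
      vplus (lp_sum p X Y) (vscale (lp_sum p X Y) a u) (vscale (lp_sum p X Y) a v)" for a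
    using u v by (simp add: sum_simps X.scale_add Y.scale_add)
  fix w assume "w \<in> carrier (lp_sum p X Y)"
  then obtain h z where "w = (h, z)" "h \<in> carrier X" "z \<in> carrier Y" by (auto simp: sum_simps)
  thus "vplus (lp_sum p X Y) (vplus (lp_sum p X Y) u v) w = vplus (lp_sum p X Y) u (vplus (lp_sum p X Y) v w)"
    using u v by (simp add: sum_simps X.add_assoc Y.add_assoc)
qed

text \<open>If \<open>f = a + b\<close> is an orthogonal splitting then so is \<open>(f, x) = (a, 0) + (b, x)\<close>, and both parts are
  nonzero as \<open>a\<close> and \<open>b\<close> are. This is impossible for an atom, so \<open>f\<close> vanishes.\<close>

lemma p_atom_second:
  assumes p2: "p \<noteq> 2" and divisible: "\<And>f. f \<in> carrier X \<Longrightarrow> vnorm X f \<noteq> 0 \<Longrightarrow> X.p_divisible f"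
    and atom: "sum.p_atom (f, x)"
  shows "vnorm X f = 0" "Y.p_atom x"
proof -
  have fx: "f \<in> carrier X" "x \<in> carrier Y" using atom by (auto simp: sum.p_atom_def sum_simps)
  show f0: "vnorm X f = 0"
  proof (rule ccontr)
    assume "vnorm X f \<noteq> 0"
    with divisible fx obtain a b where ab: "f = vplus X a b" "X.p_orth a b" "vnorm X a \<noteq> 0" "vnorm X b \<noteq> 0"
      unfolding X.p_divisible_def by blast
    note ab' = X.p_orthD[OF ab(2)]
    have "vplus Y (vscale Y \<alpha> (vscale Y 0 x)) (vscale Y \<beta> x) = vscale Y \<beta> x" for \<alpha> \<beta>
      using fx by (simp add: Y.scale_scale Y.scale_closed Y.zero_add)
    hence "sum.p_orth (a, vscale Y 0 x) (b, x)"
      using fx ab' by (simp add: sum.p_orth_def sum_simps Y.scale_closed Y.norm_zero Y.pnorm_scale distrib_left)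
    moreover have "(f, x) = vplus (lp_sum p X Y) (a, vscale Y 0 x) (b, x)"
      using ab fx by (simp add: sum_simps Y.zero_add)
    ultimately have "sum.p_divisible (f, x)"
      unfolding sum.p_divisible_def using ab(3,4) vnorm_sum_eq_0_iff by blast
    thus False using sum.p_atom_not_divisible[OF p2 atom] by blast
  qed
  have f_zero: "f = vscale X 0 f" using X.norm_0_imp f0 fx by blast
  show "Y.p_atom x"
    unfolding Y.p_atom_def
  proof (intro conjI ballI)
    show "x \<in> carrier Y" by fact
    show "vnorm Y x \<noteq> 0" using atom f0 by (simp add: sum.p_atom_def vnorm_sum_eq_0_iff)
    fix y assume y: "y \<in> carrier Y"
    hence "(f, y) \<in> carrier (lp_sum p X Y)" using fx by (simp add: sum_simps)
    then obtain c w where w: "(f, y) = vplus (lp_sum p X Y) (vscale (lp_sum p X Y) c (f, x)) w"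
      and orth: "sum.p_orth (f, x) w"
      using atom unfolding sum.p_atom_def by blast
    obtain g y' where w_eq: "w = (g, y')" by (cases w)
    note orth' = sum.p_orthD[OF orth, unfolded w_eq sum_simps]
    have gy: "g \<in> carrier X" "y' \<in> carrier Y" using orth'(2) by auto
    have scale_f: "vscale X a f = f" for a
      by (subst (1 2) f_zero) (simp add: X.scale_scale fx)
    have "f = vplus X (vscale X c f) g" using w by (simp add: w_eq sum_simps)
    also have "\<dots> = vplus X (vscale X 0 f) g" by (simp add: scale_f)
    also have "\<dots> = g" by (rule X.zero_add[OF gy(1) fx(1)])
    finally have "g = f" by simp
    have f_f: "vplus X f f = f" by (subst (2) f_zero) (simp add: X.add_zero fx)
    have "Y.p_orth x y'"
      using orth' fx gy f0 unfolding \<open>g = f\<close> Y.p_orth_def by (simp add: scale_f f_f sum_simps)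
    moreover have "y = vplus Y (vscale Y c x) y'" using w by (simp add: w_eq sum_simps)
    ultimately show "\<exists>c y'. y = vplus Y (vscale Y c x) y' \<and> Y.p_orth x y'" by blast
  qed
qed

lemma p_atom_pair:
  assumes f: "f \<in> carrier X" and e: "Y.p_atom e"
  shows "sum.p_atom (vscale X 0 f, e)"
  unfolding sum.p_atom_def
proof (intro conjI ballI)
  have e': "e \<in> carrier Y" using e by (simp add: Y.p_atom_def)
  show "(vscale X 0 f, e) \<in> carrier (lp_sum p X Y)" using f e' by (simp add: sum_simps X.scale_closed)
  show "vnorm (lp_sum p X Y) (vscale X 0 f, e) \<noteq> 0"
    using e by (simp add: vnorm_sum_eq_0_iff Y.p_atom_def)
  fix w assume "w \<in> carrier (lp_sum p X Y)"
  then obtain g y where w: "w = (g, y)" "g \<in> carrier X" "y \<in> carrier Y" by (auto simp: sum_simps)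
  obtain c y' where y: "y = vplus Y (vscale Y c e) y'" "Y.p_orth e y'"
    using e w unfolding Y.p_atom_def by blast
  note y' = Y.p_orthD[OF y(2)]
  have "w = vplus (lp_sum p X Y) (vscale (lp_sum p X Y) c (vscale X 0 f, e)) (g, y')"
    using w f y by (simp add: sum_simps X.scale_scale X.zero_add)
  moreover have "sum.p_orth (vscale X 0 f, e) (g, y')"
    using w f y' e' by (simp add: sum.p_orth_def sum_simps X.scale_closed X.scale_scale X.zero_add
        X.norm_zero X.pnorm_scale distrib_left)
  ultimately show "\<exists>c w'. w = vplus (lp_sum p X Y) (vscale (lp_sum p X Y) c (vscale X 0 f, e)) w' \<and>
      sum.p_orth (vscale X 0 f, e) w'" by blast
qed

lemma dual_space_snd:
  assumes "\<phi> \<in> dual_space Y"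
  shows "(\<lambda>u. \<phi> (snd u)) \<in> dual_space (lp_sum p X Y)"
proof -
  obtain C where C: "\<And>x. x \<in> carrier Y \<Longrightarrow> cmod (\<phi> x) \<le> C * vnorm Y x"
    using assms unfolding dual_space_def by blast
  have "cmod (\<phi> x) \<le> \<bar>C\<bar> * vnorm (lp_sum p X Y) (f, x)" if x: "x \<in> carrier Y" for f x
  proof -
    have "vnorm Y x = (vnorm Y x powr p) powr (1 / p)"
      using Y.norm_nonneg[OF x] Y.p_ge_1 by (simp add: powr_powr)
    also have "\<dots> \<le> vnorm (lp_sum p X Y) (f, x)"
      unfolding vnorm_sum using Y.p_ge_1 by (intro powr_mono2) auto
    finally have le: "vnorm Y x \<le> vnorm (lp_sum p X Y) (f, x)" .
    have "cmod (\<phi> x) \<le> \<bar>C\<bar> * vnorm Y x"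
      using C[OF x] mult_right_mono[OF abs_ge_self Y.norm_nonneg[OF x], of C] by linarith
    also have "\<dots> \<le> \<bar>C\<bar> * vnorm (lp_sum p X Y) (f, x)" using le by (intro mult_left_mono) auto
    finally show ?thesis .
  qed
  hence "\<exists>C. \<forall>u\<in>carrier (lp_sum p X Y). cmod (\<phi> (snd u)) \<le> C * vnorm (lp_sum p X Y) u"
    by (intro exI[of _ "\<bar>C\<bar>"]) (auto simp: sum_simps)
  moreover have "\<phi> (snd (vplus (lp_sum p X Y) u v)) = \<phi> (snd u) + \<phi> (snd v)"
    if "u \<in> carrier (lp_sum p X Y)" "v \<in> carrier (lp_sum p X Y)" for u v
    using assms that by (auto simp: dual_space_def sum_simps)
  moreover have "\<phi> (snd (vscale (lp_sum p X Y) c u)) = c * \<phi> (snd u)"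
    if "u \<in> carrier (lp_sum p X Y)" for c u
    using assms that by (auto simp: dual_space_def sum_simps)
  ultimately show ?thesis by (simp add: dual_space_def)
qed

end

section \<open>The blocks of \<open>S\<^sub>p\<close>\<close>

lemma Sp_carrier: "x \<in> carrier (Sp_space p) \<longleftrightarrow>
    (\<forall>k. x k \<in> carrier_mat (Suc k) (Suc k)) \<and> summable (\<lambda>k. tr_abs_powr p (x k))"
  by (simp add: Sp_space_def)

lemma Sp_blocks: "x \<in> carrier (Sp_space p) \<Longrightarrow> x k \<in> carrier_mat (Suc k) (Suc k)"
  by (simp add: Sp_carrier)

lemma Sp_ops:
  "vplus (Sp_space p) x y = (\<lambda>k. x k + y k)"
  "vscale (Sp_space p) c x = (\<lambda>k. c \<cdot>\<^sub>m x k)"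
  "vnorm (Sp_space p) x = (\<Sum>k. tr_abs_powr p (x k)) powr (1 / p)"
  by (simp_all add: Sp_space_def)

lemma suminf_tr_nonneg: "x \<in> carrier (Sp_space p) \<Longrightarrow> 0 \<le> (\<Sum>k. tr_abs_powr p (x k))"
  using tr_abs_powr_nonneg Sp_blocks by (intro suminf_nonneg) (auto simp: Sp_carrier)

lemma Sp_pnorm:
  assumes "1 \<le> p" "x \<in> carrier (Sp_space p)"
  shows "vnorm (Sp_space p) x powr p = (\<Sum>k. tr_abs_powr p (x k))"
  using assms suminf_tr_nonneg by (simp add: Sp_ops powr_powr)

lemma smult_zero_mat:
  fixes A :: "complex mat"
  assumes "A \<in> carrier_mat n n"
  shows "0 \<cdot>\<^sub>m A = 0\<^sub>m n n"
  using assms by (intro eq_matI) auto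

lemma Sp_scale_closed:
  assumes "x \<in> carrier (Sp_space p)"
  shows "vscale (Sp_space p) c x \<in> carrier (Sp_space p)"
  using assms tr_abs_powr_smult[OF Sp_blocks[OF assms]] by (simp add: Sp_carrier Sp_ops summable_mult)

lemma Sp_space_lp_normed:
  assumes p: "1 \<le> p"
  shows "lp_normed (Sp_space p) p"
proof
  fix x assume x: "x \<in> carrier (Sp_space p)"
  note xk = Sp_blocks[OF x]
  show "vscale (Sp_space p) c x \<in> carrier (Sp_space p)" for c
    using x by (rule Sp_scale_closed)
  show "0 \<le> vnorm (Sp_space p) x" by (simp add: Sp_ops)
  show "vnorm (Sp_space p) (vscale (Sp_space p) c x) = cmod c * vnorm (Sp_space p) x" for c
  proof -
    have "(\<Sum>k. tr_abs_powr p (c \<cdot>\<^sub>m x k)) = cmod c powr p * (\<Sum>k. tr_abs_powr p (x k))"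
      using x by (simp add: tr_abs_powr_smult[OF xk] suminf_mult Sp_carrier)
    thus ?thesis using p suminf_tr_nonneg[OF x] by (simp add: Sp_ops powr_mult powr_powr)
  qed
  show "x = vscale (Sp_space p) 0 x" if "vnorm (Sp_space p) x = 0"
  proof
    fix k
    have "(\<Sum>k. tr_abs_powr p (x k)) = 0" using that by (simp add: Sp_ops)
    hence "tr_abs_powr p (x k) = 0"
      using x tr_abs_powr_nonneg[OF xk] by (subst (asm) suminf_eq_zero_iff) (auto simp: Sp_carrier)
    thus "x k = vscale (Sp_space p) 0 x k"
      using tr_abs_powr_eq_0_imp[OF xk] smult_zero_mat[OF xk] by (simp add: Sp_ops)
  qed
  show "vscale (Sp_space p) (a + b) x = vplus (Sp_space p) (vscale (Sp_space p) a x) (vscale (Sp_space p) b x)" for a b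
    using add_smult_distrib_right_mat[OF xk] by (simp add: Sp_ops)
  show "vscale (Sp_space p) a (vscale (Sp_space p) b x) = vscale (Sp_space p) (a * b) x" for a b
    by (auto simp: Sp_ops mult.assoc intro!: eq_matI)
  show "vscale (Sp_space p) 1 x = x" by (auto simp: Sp_ops intro!: eq_matI)
  fix y assume y: "y \<in> carrier (Sp_space p)"
  note yk = Sp_blocks[OF y]
  show "vplus (Sp_space p) x y = vplus (Sp_space p) y x"
    unfolding Sp_ops using xk yk by (intro ext comm_add_mat)
  show "vplus (Sp_space p) x (vscale (Sp_space p) 0 y) = x"
    using right_add_zero_mat[OF xk] by (simp add: Sp_ops smult_zero_mat[OF yk])
  show "vscale (Sp_space p) a (vplus (Sp_space p) x y) =
      vplus (Sp_space p) (vscale (Sp_space p) a x) (vscale (Sp_space p) a y)" for a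
    using add_smult_distrib_left_mat[OF xk yk] by (simp add: Sp_ops)
  fix z assume z: "z \<in> carrier (Sp_space p)"
  note zk = Sp_blocks[OF z]
  show "vplus (Sp_space p) (vplus (Sp_space p) x y) z = vplus (Sp_space p) x (vplus (Sp_space p) y z)"
    unfolding Sp_ops using xk yk zk by (intro ext assoc_add_mat)
qed (rule p)

lemma Sp_p_orth_if_disjoint_blocks:
  assumes p: "1 \<le> p" and x: "x \<in> carrier (Sp_space p)" and y: "y \<in> carrier (Sp_space p)"
    and disj: "\<And>k. x k = 0\<^sub>m (Suc k) (Suc k) \<or> y k = 0\<^sub>m (Suc k) (Suc k)"
  shows "lp_normed.p_orth (Sp_space p) p x y"
proof -
  interpret lp_normed "Sp_space p" p by (rule Sp_space_lp_normed[OF p])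
  note xk = Sp_blocks[OF x] and yk = Sp_blocks[OF y]
  have tr: "tr_abs_powr p (a \<cdot>\<^sub>m x k + b \<cdot>\<^sub>m y k) =
      cmod a powr p * tr_abs_powr p (x k) + cmod b powr p * tr_abs_powr p (y k)" for a b k
    using disj[of k]
  proof
    assume x0: "x k = 0\<^sub>m (Suc k) (Suc k)"
    have "a \<cdot>\<^sub>m x k + b \<cdot>\<^sub>m y k = b \<cdot>\<^sub>m y k" using yk[of k] by (simp add: x0)
    thus ?thesis by (simp add: tr_abs_powr_smult[OF yk] x0 tr_abs_powr_zero)
  next
    assume y0: "y k = 0\<^sub>m (Suc k) (Suc k)"
    have "a \<cdot>\<^sub>m x k + b \<cdot>\<^sub>m y k = a \<cdot>\<^sub>m x k" using xk[of k] by (simp add: y0)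
    thus ?thesis by (simp add: tr_abs_powr_smult[OF xk] y0 tr_abs_powr_zero)
  qed
  have sx: "summable (\<lambda>k. cmod a powr p * tr_abs_powr p (x k))"
    and sy: "summable (\<lambda>k. cmod a powr p * tr_abs_powr p (y k))" for a
    using x y by (auto simp: Sp_carrier intro: summable_mult)
  have closed: "vplus (Sp_space p) (vscale (Sp_space p) a x) (vscale (Sp_space p) b y) \<in> carrier (Sp_space p)" for a b
    using xk yk sx sy by (simp add: Sp_carrier Sp_ops tr summable_add)
  show ?thesis
    unfolding p_orth_def
  proof (intro conjI allI x y closed)
    fix a b
    have "(\<Sum>k. tr_abs_powr p (a \<cdot>\<^sub>m x k + b \<cdot>\<^sub>m y k)) =
        cmod a powr p * (\<Sum>k. tr_abs_powr p (x k)) + cmod b powr p * (\<Sum>k. tr_abs_powr p (y k))"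
      using x y by (simp add: tr suminf_add[OF sx sy, symmetric] suminf_mult Sp_carrier)
    thus "pnorm (vplus (Sp_space p) (vscale (Sp_space p) a x) (vscale (Sp_space p) b y)) =
        cmod a powr p * pnorm x + cmod b powr p * pnorm y"
      using Sp_pnorm[OF p] x y closed[of a b] by (simp add: Sp_ops(1,2))
  qed
qed

definition Sp_restrict :: "nat set \<Rightarrow> (nat \<Rightarrow> complex mat) \<Rightarrow> nat \<Rightarrow> complex mat" where
  "Sp_restrict K x k = (if k \<in> K then x k else 0\<^sub>m (Suc k) (Suc k))"

lemma Sp_restrict_closed:
  assumes x: "x \<in> carrier (Sp_space p)"
  shows "Sp_restrict K x \<in> carrier (Sp_space p)"
proof -
  have "summable (\<lambda>k. tr_abs_powr p (Sp_restrict K x k))"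
  proof (rule summable_comparison_test')
    show "summable (\<lambda>k. tr_abs_powr p (x k))" using x by (simp add: Sp_carrier)
    show "norm (tr_abs_powr p (Sp_restrict K x k)) \<le> tr_abs_powr p (x k)" for k
      using tr_abs_powr_nonneg[OF Sp_blocks[OF x]] by (simp add: Sp_restrict_def tr_abs_powr_zero)
  qed
  thus ?thesis using Sp_blocks[OF x] by (simp add: Sp_carrier Sp_restrict_def)
qed

lemma Sp_restrict_add:
  assumes x: "x \<in> carrier (Sp_space p)"
  shows "x = vplus (Sp_space p) (Sp_restrict K x) (Sp_restrict (- K) x)"
  using Sp_blocks[OF x] by (auto simp: Sp_ops Sp_restrict_def fun_eq_iff)

text \<open>For a nonzero block \<open>k\<close>, the atom is the orthogonal sum of its block \<open>k\<close> and the rest, so the rest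
  vanishes.\<close>

lemma Sp_p_atom_one_block:
  assumes p: "1 \<le> p" "p \<noteq> 2" and x: "lp_normed.p_atom (Sp_space p) p x"
  obtains k where "x k \<noteq> 0\<^sub>m (Suc k) (Suc k)" "\<And>j. j \<noteq> k \<Longrightarrow> x j = 0\<^sub>m (Suc j) (Suc j)"
proof -
  interpret lp_normed "Sp_space p" p by (rule Sp_space_lp_normed[OF p(1)])
  have xc: "x \<in> carrier (Sp_space p)" and nz: "vnorm (Sp_space p) x \<noteq> 0" using x by (auto simp: p_atom_def)
  have zero: "y j = 0\<^sub>m (Suc j) (Suc j)" if "y \<in> carrier (Sp_space p)" "vnorm (Sp_space p) y = 0" for y j
    using norm_0_imp[OF that] smult_zero_mat[OF Sp_blocks[OF that(1)]] by (metis Sp_ops(2))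
  have "\<exists>k. x k \<noteq> 0\<^sub>m (Suc k) (Suc k)"
  proof (rule ccontr)
    assume "\<not> ?thesis"
    thus False using nz by (simp add: Sp_ops tr_abs_powr_zero)
  qed
  then obtain k where k: "x k \<noteq> 0\<^sub>m (Suc k) (Suc k)" by blast
  have "p_orth (Sp_restrict {k} x) (Sp_restrict (- {k}) x)"
    using xc by (intro Sp_p_orth_if_disjoint_blocks[OF p(1)] Sp_restrict_closed) (auto simp: Sp_restrict_def)
  hence "vnorm (Sp_space p) (Sp_restrict {k} x) = 0 \<or> vnorm (Sp_space p) (Sp_restrict (- {k}) x) = 0"
    using p_atom_not_divisible[OF p(2) x] Sp_restrict_add[OF xc] unfolding p_divisible_def by blast
  moreover have "vnorm (Sp_space p) (Sp_restrict {k} x) \<noteq> 0"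
    using zero[OF Sp_restrict_closed[OF xc], of "{k}" k] k by (auto simp: Sp_restrict_def)
  ultimately have "Sp_restrict (- {k}) x j = 0\<^sub>m (Suc j) (Suc j)" for j
    using zero[OF Sp_restrict_closed[OF xc]] by blast
  hence "x j = 0\<^sub>m (Suc j) (Suc j)" if "j \<noteq> k" for j
    using that unfolding Sp_restrict_def by (metis ComplI singletonD)
  thus ?thesis using that k by blast
qed

section \<open>Atoms of \<open>S\<^sub>p\<close>\<close>

text \<open>Self-adjoint unitaries.\<close>

definition symmetry_mat :: "nat \<Rightarrow> complex mat \<Rightarrow> bool" where
  "symmetry_mat n u \<longleftrightarrow> u \<in> carrier_mat n n \<and> mat_adjoint u = u \<and> u * u = 1\<^sub>m n"

lemma symmetry_mat_unitary: "symmetry_mat n u \<Longrightarrow> unitary_mat n u"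
  by (simp add: symmetry_mat_def unitary_mat_def)

text \<open>\<open>w = (1 + \<i> u) / \<surd>2\<close> is unitary because \<open>w\<^sup>* w = (1 - \<i> u) (1 + \<i> u) / 2 = (1 + u\<^sup>2) / 2\<close>.\<close>

lemma symmetry_mat_rotation:
  assumes u: "symmetry_mat n u"
  defines "s \<equiv> complex_of_real (1 / sqrt 2)"
  obtains w where "unitary_mat n w"
    "\<And>X. X \<in> carrier_mat n n \<Longrightarrow> w * X = s \<cdot>\<^sub>m X + (s * \<i>) \<cdot>\<^sub>m (u * X)"
proof -
  have uc: "u \<in> carrier_mat n n" "mat_adjoint u = u" "u * u = 1\<^sub>m n"
    using u by (auto simp: symmetry_mat_def)
  have comb: "(a \<cdot>\<^sub>m 1\<^sub>m n + b \<cdot>\<^sub>m u) * X = a \<cdot>\<^sub>m X + b \<cdot>\<^sub>m (u * X)"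
    if X: "X \<in> carrier_mat n n" for a b X
  proof -
    have "(a \<cdot>\<^sub>m 1\<^sub>m n + b \<cdot>\<^sub>m u) * X = (a \<cdot>\<^sub>m 1\<^sub>m n) * X + (b \<cdot>\<^sub>m u) * X"
      by (rule add_mult_distrib_mat[where nr = n and n = n and nc = n]) (use uc X in auto)
    also have "\<dots> = a \<cdot>\<^sub>m X + b \<cdot>\<^sub>m (u * X)"
      using X uc by (simp add: mult_smult_assoc_mat[where nr = n and n = n and nc = n])
    finally show ?thesis .
  qed
  have ss: "s * s = 1 / 2" "cnj s = s"
    by (simp_all add: s_def flip: of_real_mult)
  define w where "w = s \<cdot>\<^sub>m 1\<^sub>m n + (s * \<i>) \<cdot>\<^sub>m u"
  have w: "w \<in> carrier_mat n n" using uc by (simp add: w_def)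
  have "mat_adjoint w = s \<cdot>\<^sub>m 1\<^sub>m n + (- s * \<i>) \<cdot>\<^sub>m u"
  proof (rule eq_matI)
    fix i j assume "i < dim_row (s \<cdot>\<^sub>m 1\<^sub>m n + (- s * \<i>) \<cdot>\<^sub>m u)" "j < dim_col (s \<cdot>\<^sub>m 1\<^sub>m n + (- s * \<i>) \<cdot>\<^sub>m u)"
    hence ij: "i < n" "j < n" using uc by auto
    have "cnj (u $$ (j, i)) = u $$ (i, j)" using mat_adjoint_index[of i u j] ij uc by simp
    thus "mat_adjoint w $$ (i, j) = (s \<cdot>\<^sub>m 1\<^sub>m n + (- s * \<i>) \<cdot>\<^sub>m u) $$ (i, j)"
      using ij uc ss w by (auto simp: mat_adjoint_index w_def)
  qed (use w uc in auto)
  hence "mat_adjoint w * w = s \<cdot>\<^sub>m w + (- s * \<i>) \<cdot>\<^sub>m (u * w)"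
    using comb[OF w] by simp
  also have "u * w = s \<cdot>\<^sub>m u + (s * \<i>) \<cdot>\<^sub>m 1\<^sub>m n"
    unfolding w_def using uc
    by (simp add: mult_add_distrib_mat[where nr = n and n = n and nc = n]
        mult_smult_distrib[where nr = n and n = n and nc = n])
  also have "s \<cdot>\<^sub>m w + (- s * \<i>) \<cdot>\<^sub>m (s \<cdot>\<^sub>m u + (s * \<i>) \<cdot>\<^sub>m 1\<^sub>m n) = 1\<^sub>m n"
  proof (rule eq_matI)
    have scalar: "s * (s * a + s * \<i> * b) + - s * \<i> * (s * b + s * \<i> * a) = a" for a b
    proof -
      have "s * (s * a + s * \<i> * b) + - s * \<i> * (s * b + s * \<i> * a) = (s * s) * (a - \<i> * \<i> * a)"
        by (simp only: ring_distribs mult_minus_left minus_mult_left[symmetric] mult_ac) simp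
      thus ?thesis unfolding ss(1) by simp
    qed
    fix i j assume "i < dim_row (1\<^sub>m n :: complex mat)" "j < dim_col (1\<^sub>m n :: complex mat)"
    hence ij: "i < n" "j < n" by auto
    have ud: "dim_row u = n" "dim_col u = n" using uc by auto
    have "(s \<cdot>\<^sub>m w + (- s * \<i>) \<cdot>\<^sub>m (s \<cdot>\<^sub>m u + (s * \<i>) \<cdot>\<^sub>m 1\<^sub>m n)) $$ (i, j) =
        s * (s * 1\<^sub>m n $$ (i, j) + s * \<i> * u $$ (i, j)) + - s * \<i> * (s * u $$ (i, j) + s * \<i> * 1\<^sub>m n $$ (i, j))"
      using ij by (simp add: w_def ud del: index_one_mat(1))
    thus "(s \<cdot>\<^sub>m w + (- s * \<i>) \<cdot>\<^sub>m (s \<cdot>\<^sub>m u + (s * \<i>) \<cdot>\<^sub>m 1\<^sub>m n)) $$ (i, j) = 1\<^sub>m n $$ (i, j)"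
      unfolding scalar .
  qed (use uc in \<open>auto simp: w_def\<close>)
  finally have "unitary_mat n w" using w by (simp add: unitary_mat_def)
  thus ?thesis using that comb unfolding w_def by blast
qed

definition signed_perm_mat :: "nat \<Rightarrow> (nat \<Rightarrow> nat) \<Rightarrow> (nat \<Rightarrow> complex) \<Rightarrow> complex mat" where
  "signed_perm_mat n \<sigma> \<epsilon> = Matrix.mat n n (\<lambda>(i, j). if j = \<sigma> i then \<epsilon> i else 0)"

lemma signed_perm_mat_times_index:
  assumes X: "X \<in> carrier_mat n m" and i: "i < n" "\<sigma> i < n" and l: "l < m"
  shows "(signed_perm_mat n \<sigma> \<epsilon> * X) $$ (i, l) = \<epsilon> i * X $$ (\<sigma> i, l)"
proof -
  have "(signed_perm_mat n \<sigma> \<epsilon> * X) $$ (i, l) = (\<Sum>k<n. signed_perm_mat n \<sigma> \<epsilon> $$ (i, k) * X $$ (k, l))"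
    by (rule times_mat_index) (use X i l in \<open>auto simp: signed_perm_mat_def\<close>)
  also have "\<dots> = (\<Sum>k<n. if k = \<sigma> i then \<epsilon> i * X $$ (\<sigma> i, l) else 0)"
    using i by (intro sum.cong refl) (simp add: signed_perm_mat_def)
  finally show ?thesis using i by simp
qed

lemma signed_perm_mat_symmetry:
  assumes \<sigma>: "\<And>i. i < n \<Longrightarrow> \<sigma> i < n" "\<And>i. \<sigma> (\<sigma> i) = i"
    and \<epsilon>: "\<And>i. \<epsilon> (\<sigma> i) = \<epsilon> i" "\<And>i. \<epsilon> i = 1 \<or> \<epsilon> i = -1"
  shows "symmetry_mat n (signed_perm_mat n \<sigma> \<epsilon>)"
proof -
  let ?u = "signed_perm_mat n \<sigma> \<epsilon>"
  have u: "?u \<in> carrier_mat n n" by (simp add: signed_perm_mat_def)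
  have real: "cnj (\<epsilon> i) = \<epsilon> i" "\<epsilon> i * \<epsilon> i = 1" for i using \<epsilon>(2)[of i] by auto
  have flip: "i = \<sigma> j \<longleftrightarrow> j = \<sigma> i" for i j using \<sigma>(2) by metis
  have "mat_adjoint ?u = ?u"
    using real \<epsilon>(1) flip by (intro eq_matI) (auto simp: mat_adjoint_index signed_perm_mat_def)
  moreover have "?u * ?u = 1\<^sub>m n"
  proof (rule eq_matI)
    fix i j assume "i < dim_row (1\<^sub>m n :: complex mat)" "j < dim_col (1\<^sub>m n :: complex mat)"
    hence ij: "i < n" "j < n" by auto
    show "(?u * ?u) $$ (i, j) = 1\<^sub>m n $$ (i, j)"
      unfolding signed_perm_mat_times_index[where \<sigma> = \<sigma>, OF u ij(1) \<sigma>(1)[OF ij(1)] ij(2)]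
      using ij \<sigma> \<epsilon>(1) real by (auto simp: signed_perm_mat_def)
  qed (use u in auto)
  ultimately show ?thesis using u by (simp add: symmetry_mat_def)
qed

text \<open>Suppose that every symmetry maps \<open>X\<close> to a multiple of \<open>X\<close>, and let row \<open>i\<close> be nonzero. The symmetry that changes
  the sign of row \<open>i\<close> can only act as \<open>-1\<close>, so all other rows vanish; but then exchanging row \<open>i\<close> with
  another row does not produce a multiple of \<open>X\<close>.\<close>

lemma symmetry_mat_moves_line:
  fixes X :: "complex mat"
  assumes X: "X \<in> carrier_mat n n" "X \<noteq> 0\<^sub>m n n" and n: "2 \<le> n"
  shows "\<exists>u. symmetry_mat n u \<and> (\<forall>c. u * X \<noteq> c \<cdot>\<^sub>m X)"
proof (rule ccontr)
  assume "\<not> ?thesis"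
  hence line: "\<exists>c. u * X = c \<cdot>\<^sub>m X" if "symmetry_mat n u" for u using that by blast
  obtain i l where il: "i < n" "l < n" "X $$ (i, l) \<noteq> 0"
    using X by (metis carrier_matD eq_matI index_zero_mat)
  define j where "j = (if i = 0 then 1 else 0 :: nat)"
  have j: "j < n" "j \<noteq> i" using n by (auto simp: j_def)
  have Xd: "dim_row X = n" "dim_col X = n" using X by auto
  let ?\<epsilon> = "\<lambda>k. if k = i then -1 else 1"
  obtain c where c: "signed_perm_mat n id ?\<epsilon> * X = c \<cdot>\<^sub>m X"
    using line[OF signed_perm_mat_symmetry[of n id ?\<epsilon>]] by fastforce
  have row: "?\<epsilon> k * X $$ (k, l) = c * X $$ (k, l)" if "k < n" for k
    using arg_cong[OF c, of "\<lambda>A. A $$ (k, l)"] signed_perm_mat_times_index[OF X(1) that, of id l ?\<epsilon>] that il Xd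
    by simp
  have "c * X $$ (i, l) = -1 * X $$ (i, l)" using row[OF il(1)] by simp
  hence "c = -1" using il(3) mult_right_cancel by blast
  hence Xj: "X $$ (j, l) = 0" using row[OF j(1)] j by simp
  let ?\<sigma> = "Transposition.transpose i j"
  have \<sigma>: "?\<sigma> k < n" if "k < n" for k using that il j by (simp add: Transposition.transpose_def)
  obtain d where d: "signed_perm_mat n ?\<sigma> (\<lambda>_. 1) * X = d \<cdot>\<^sub>m X"
    using line[OF signed_perm_mat_symmetry[of n ?\<sigma> "\<lambda>_. 1"]] \<sigma> by auto
  have "X $$ (i, l) = d * X $$ (j, l)"
    using arg_cong[OF d, of "\<lambda>A. A $$ (j, l)"] signed_perm_mat_times_index[where \<sigma> = ?\<sigma>, OF X(1) j(1) \<sigma>[OF j(1)] il(2), of "\<lambda>_. 1"] j il Xd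
    by simp
  thus False using Xj il by simp
qed

definition Sp_block_map :: "nat \<Rightarrow> complex mat \<Rightarrow> (nat \<Rightarrow> complex mat) \<Rightarrow> nat \<Rightarrow> complex mat" where
  "Sp_block_map k u x = x(k := u * x k)"

lemma Sp_block_map_isometry:
  assumes u: "symmetry_mat (Suc k) u"
  shows "linear_isometry (Sp_space p) (Sp_block_map k u)"
proof -
  have uc: "u \<in> carrier_mat (Suc k) (Suc k)" "u * u = 1\<^sub>m (Suc k)" using u by (auto simp: symmetry_mat_def)
  have tr: "tr_abs_powr p (Sp_block_map k u x j) = tr_abs_powr p (x j)" if "x \<in> carrier (Sp_space p)" for x j
    using tr_abs_powr_unitary_times[OF symmetry_mat_unitary[OF u] Sp_blocks[OF that]]
    by (simp add: Sp_block_map_def)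
  have closed: "Sp_block_map k u x \<in> carrier (Sp_space p)" if x: "x \<in> carrier (Sp_space p)" for x
    using x tr[OF x] mult_carrier_mat[OF uc(1) Sp_blocks[OF x]]
    by (simp add: Sp_carrier) (simp add: Sp_block_map_def)
  have invol: "Sp_block_map k u (Sp_block_map k u x) = x" if x: "x \<in> carrier (Sp_space p)" for x
    using assoc_mult_mat[OF uc(1) uc(1) Sp_blocks[OF x]] left_mult_one_mat[OF Sp_blocks[OF x]] uc(2)
    by (auto simp: Sp_block_map_def fun_eq_iff)
  have "is_linear_on (Sp_space p) (Sp_block_map k u)"
    unfolding is_linear_on_def
  proof (intro conjI ballI allI)
    fix x assume x: "x \<in> carrier (Sp_space p)"
    show "Sp_block_map k u (vscale (Sp_space p) c x) = vscale (Sp_space p) c (Sp_block_map k u x)" for c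
      using mult_smult_distrib[OF uc(1) Sp_blocks[OF x]] by (auto simp: Sp_block_map_def Sp_ops fun_eq_iff)
    fix y assume y: "y \<in> carrier (Sp_space p)"
    show "Sp_block_map k u (vplus (Sp_space p) x y) = vplus (Sp_space p) (Sp_block_map k u x) (Sp_block_map k u y)"
      using mult_add_distrib_mat[OF uc(1) Sp_blocks[OF x] Sp_blocks[OF y]]
      by (auto simp: Sp_block_map_def Sp_ops fun_eq_iff)
  qed
  moreover have "Sp_block_map k u ` carrier (Sp_space p) = carrier (Sp_space p)"
    using closed invol by force
  moreover have "vnorm (Sp_space p) (Sp_block_map k u x) = vnorm (Sp_space p) x" if "x \<in> carrier (Sp_space p)" for x
    using tr[OF that] by (simp add: Sp_ops)
  ultimately show ?thesis by (simp add: linear_isometry_def)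
qed

definition Sp_unit :: "nat \<Rightarrow> complex mat" where
  "Sp_unit k = (if k = 0 then 1\<^sub>m 1 else 0\<^sub>m (Suc k) (Suc k))"

lemma Sp_unit_closed: "Sp_unit \<in> carrier (Sp_space p)"
proof -
  have "summable (\<lambda>k. tr_abs_powr p (Sp_unit k))"
    by (rule summable_finite[of "{0}"]) (auto simp: Sp_unit_def tr_abs_powr_zero)
  thus ?thesis by (auto simp: Sp_carrier Sp_unit_def)
qed

lemma one_by_one_mat:
  fixes A :: "complex mat"
  shows "A \<in> carrier_mat (Suc 0) (Suc 0) \<Longrightarrow> A = (A $$ (0, 0)) \<cdot>\<^sub>m 1\<^sub>m (Suc 0)"
  by (intro eq_matI) auto

lemma tr_abs_powr_one_pos: "0 < tr_abs_powr p (1\<^sub>m (Suc 0))"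
proof -
  have "(1\<^sub>m (Suc 0) :: complex mat) $$ (0, 0) \<noteq> 0\<^sub>m (Suc 0) (Suc 0) $$ (0, 0)" by simp
  hence "(1\<^sub>m (Suc 0) :: complex mat) \<noteq> 0\<^sub>m (Suc 0) (Suc 0)" by metis
  hence "tr_abs_powr p (1\<^sub>m (Suc 0)) \<noteq> 0" using tr_abs_powr_eq_0_imp[of "1\<^sub>m (Suc 0)" "Suc 0" p] by auto
  thus ?thesis using tr_abs_powr_nonneg[of "1\<^sub>m (Suc 0)" "Suc 0" p] by simp
qed

lemma tr_abs_powr_first_block:
  assumes "x \<in> carrier (Sp_space p)"
  shows "cmod (x 0 $$ (0, 0)) powr p * tr_abs_powr p (1\<^sub>m (Suc 0)) \<le> (\<Sum>k. tr_abs_powr p (x k))"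
proof -
  have x0: "x 0 \<in> carrier_mat (Suc 0) (Suc 0)" using Sp_blocks[OF assms, of 0] .
  have "tr_abs_powr p (x 0) = cmod (x 0 $$ (0, 0)) powr p * tr_abs_powr p (1\<^sub>m (Suc 0))"
    by (subst one_by_one_mat[OF x0]) (rule tr_abs_powr_smult[where n = "Suc 0"], simp)
  moreover have "(\<Sum>k\<in>{0}. tr_abs_powr p (x k)) \<le> (\<Sum>k. tr_abs_powr p (x k))"
    using assms tr_abs_powr_nonneg[OF Sp_blocks[OF assms]] by (intro sum_le_suminf) (auto simp: Sp_carrier)
  ultimately show ?thesis by simp
qed

lemma Sp_unit_p_atom:
  assumes p: "1 \<le> p"
  shows "lp_normed.p_atom (Sp_space p) p Sp_unit"
proof -
  interpret lp_normed "Sp_space p" p by (rule Sp_space_lp_normed[OF p])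
  have "0 < (\<Sum>k. tr_abs_powr p (Sp_unit k))"
    using tr_abs_powr_first_block[OF Sp_unit_closed, of p] tr_abs_powr_one_pos[of p] by (simp add: Sp_unit_def)
  hence nz: "vnorm (Sp_space p) Sp_unit \<noteq> 0" by (simp add: Sp_ops)
  have "\<exists>c y'. y = vplus (Sp_space p) (vscale (Sp_space p) c Sp_unit) y' \<and> p_orth Sp_unit y'"
    if y: "y \<in> carrier (Sp_space p)" for y
  proof (intro exI conjI)
    have "y 0 = (y 0 $$ (0, 0)) \<cdot>\<^sub>m 1\<^sub>m (Suc 0)"
      using one_by_one_mat Sp_blocks[OF y, of 0] by simp
    thus "y = vplus (Sp_space p) (vscale (Sp_space p) (y 0 $$ (0, 0)) Sp_unit) (Sp_restrict (- {0}) y)"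
      using Sp_blocks[OF y] by (auto simp: Sp_ops Sp_unit_def Sp_restrict_def fun_eq_iff)
    show "p_orth Sp_unit (Sp_restrict (- {0}) y)"
      using y by (intro Sp_p_orth_if_disjoint_blocks[OF p] Sp_unit_closed Sp_restrict_closed)
        (auto simp: Sp_unit_def Sp_restrict_def)
  qed
  thus ?thesis using nz Sp_unit_closed by (simp add: p_atom_def)
qed

text \<open>If the atom \<open>x\<close> lived in a larger block, then \<open>x\<close> and its image under a symmetry that moves its line
  would be orthogonal atoms, which contradicts the unitary rotation of one into the other.\<close>

lemma Sp_p_atom_first_block:
  assumes p: "1 \<le> p" "p \<noteq> 2" and x: "lp_normed.p_atom (Sp_space p) p x"
  shows "\<exists>c. x = vscale (Sp_space p) c Sp_unit"
proof -
  interpret lp_normed "Sp_space p" p by (rule Sp_space_lp_normed[OF p(1)])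
  have xc: "x \<in> carrier (Sp_space p)" and nz: "vnorm (Sp_space p) x \<noteq> 0" using x by (auto simp: p_atom_def)
  note xk = Sp_blocks[OF xc]
  obtain k where k: "x k \<noteq> 0\<^sub>m (Suc k) (Suc k)" "\<And>j. j \<noteq> k \<Longrightarrow> x j = 0\<^sub>m (Suc j) (Suc j)"
    using Sp_p_atom_one_block[OF p x] by blast
  have "k = 0"
  proof (rule ccontr)
    assume "k \<noteq> 0"
    then obtain u where u: "symmetry_mat (Suc k) u" and moves: "\<And>c. u * x k \<noteq> c \<cdot>\<^sub>m x k"
      using symmetry_mat_moves_line[OF xk k(1)] by fastforce
    let ?U = "Sp_block_map k u"
    have iso: "linear_isometry (Sp_space p) ?U" by (rule Sp_block_map_isometry[OF u])
    have "?U x \<noteq> vscale (Sp_space p) c x" for c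
      using moves[of c] by (auto simp: Sp_block_map_def Sp_ops fun_eq_iff)
    with p_atoms_parallel_or_orth[OF p(2) x p_atom_linear_isometry[OF iso x]]
    have orth: "p_orth x (?U x)" by blast
    let ?s = "complex_of_real (1 / sqrt 2)"
    obtain w where w: "unitary_mat (Suc k) w"
      "\<And>X. X \<in> carrier_mat (Suc k) (Suc k) \<Longrightarrow> w * X = ?s \<cdot>\<^sub>m X + (?s * \<i>) \<cdot>\<^sub>m (u * X)"
      using symmetry_mat_rotation[OF u] by blast
    let ?y = "vplus (Sp_space p) (vscale (Sp_space p) ?s x) (vscale (Sp_space p) (?s * \<i>) (?U x))"
    have "tr_abs_powr p (?y j) = tr_abs_powr p (x j)" for j
    proof (cases "j = k")
      case True
      have "?y j = w * x k" using w(2)[OF xk] by (simp add: True Sp_ops Sp_block_map_def)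
      thus ?thesis using tr_abs_powr_unitary_times[OF w(1) xk] by (simp add: True)
    next
      case False
      have "?y j = 0\<^sub>m (Suc j) (Suc j)"
        by (rule eq_matI) (auto simp: Sp_ops Sp_block_map_def False k(2))
      thus ?thesis by (simp add: k(2)[OF False])
    qed
    hence "vnorm (Sp_space p) ?y = vnorm (Sp_space p) x" by (simp only: Sp_ops(3))
    thus False
      using p_orth_rotation_norm_neq[OF p(2) orth] iso nz xc by (simp add: linear_isometry_def)
  qed
  have "x 0 = (x 0 $$ (0, 0)) \<cdot>\<^sub>m 1\<^sub>m (Suc 0)" using one_by_one_mat xk[of 0] by simp
  hence "x = vscale (Sp_space p) (x 0 $$ (0, 0)) Sp_unit"
    using k(2) \<open>k = 0\<close> by (auto simp: Sp_ops Sp_unit_def fun_eq_iff)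
  thus ?thesis by blast
qed

text \<open>On a \<open>1 \<times> 1\<close> matrix \<open>Tr |x|\<^sup>p\<close> is a multiple of \<open>|x|\<^sup>p\<close> by homogeneity, and the multiple is
  positive by definiteness.\<close>

lemma Sp_first_entry_dual:
  assumes p: "1 \<le> p"
  shows "(\<lambda>x. x 0 $$ (0, 0)) \<in> dual_space (Sp_space p)"
proof -
  define C where "C = (1 / tr_abs_powr p (1\<^sub>m (Suc 0))) powr (1 / p)"
  have bound: "cmod (x 0 $$ (0, 0)) \<le> C * vnorm (Sp_space p) x" if x: "x \<in> carrier (Sp_space p)" for x
  proof -
    let ?t = "tr_abs_powr p (1\<^sub>m (Suc 0))" and ?S = "\<Sum>k. tr_abs_powr p (x k)"
    have "cmod (x 0 $$ (0, 0)) powr p \<le> 1 / ?t * ?S"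
      using tr_abs_powr_first_block[OF x] tr_abs_powr_one_pos[of p] by (simp add: field_simps)
    hence "(cmod (x 0 $$ (0, 0)) powr p) powr (1 / p) \<le> (1 / ?t * ?S) powr (1 / p)"
      using p by (intro powr_mono2) auto
    also have "\<dots> = C * vnorm (Sp_space p) x"
      using suminf_tr_nonneg[OF x] tr_abs_powr_one_pos[of p] by (simp add: C_def Sp_ops powr_mult powr_divide)
    finally show ?thesis using p by (simp add: powr_powr)
  qed
  have "x 0 \<in> carrier_mat (Suc 0) (Suc 0)" if "x \<in> carrier (Sp_space p)" for x
    using Sp_blocks[OF that, of 0] .
  thus ?thesis using bound by (fastforce simp: dual_space_def Sp_ops)
qed

section \<open>Vanishing coefficients\<close>

lemma compact_if_vanishing_coefficients_Sp:
  assumes p: "1 \<le> p" "p \<noteq> 2" and top: "topspace T = carrier G"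
    and rep: "orthogonal_rep G T (Sp_space p) \<pi>" and van: "vanishing_coefficients T (Sp_space p) \<pi>"
  shows "compact_space T"
proof -
  interpret lp_normed "Sp_space p" p by (rule Sp_space_lp_normed[OF p(1)])
  show ?thesis
  proof (rule compact_if_vanishing_coefficients[OF rep van top])
    show "Sp_unit \<in> carrier (Sp_space p)" by (rule Sp_unit_closed)
    show "(\<lambda>x. x 0 $$ (0, 0)) \<in> dual_space (Sp_space p)" by (rule Sp_first_entry_dual[OF p(1)])
    show "Sp_unit 0 $$ (0, 0) \<noteq> 0" by (simp add: Sp_unit_def)
    show "\<exists>c. U Sp_unit = vscale (Sp_space p) c Sp_unit" if "linear_isometry (Sp_space p) U" for U
      by (rule Sp_p_atom_first_block[OF p p_atom_linear_isometry[OF that Sp_unit_p_atom[OF p(1)]]])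
  qed
qed

lemma compact_if_vanishing_coefficients_lp_sum_Sp:
  assumes p: "1 \<le> p" "p \<noteq> 2" and X: "lp_normed X p" and f: "f \<in> carrier X"
    and div: "\<And>f. f \<in> carrier X \<Longrightarrow> vnorm X f \<noteq> 0 \<Longrightarrow> lp_normed.p_divisible X p f"
    and top: "topspace T = carrier G"
    and rep: "orthogonal_rep G T (lp_sum p X (Sp_space p)) \<pi>"
    and van: "vanishing_coefficients T (lp_sum p X (Sp_space p)) \<pi>"
  shows "compact_space T"
proof -
  interpret lp_normed_pair X "Sp_space p" p
    by (rule lp_normed_pair.intro[OF X Sp_space_lp_normed[OF p(1)]])
  let ?e = "(vscale X 0 f, Sp_unit)"
  have atom: "sum.p_atom ?e" by (rule p_atom_pair[OF f Sp_unit_p_atom[OF p(1)]])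
  show ?thesis
  proof (rule sum.compact_if_vanishing_coefficients[OF rep van top])
    show "?e \<in> carrier (lp_sum p X (Sp_space p))" using atom by (simp add: sum.p_atom_def)
    show "(\<lambda>u. snd u 0 $$ (0, 0)) \<in> dual_space (lp_sum p X (Sp_space p))"
      by (rule dual_space_snd[OF Sp_first_entry_dual[OF p(1)]])
    show "snd ?e 0 $$ (0, 0) \<noteq> 0" by (simp add: Sp_unit_def)
    fix U assume U: "linear_isometry (lp_sum p X (Sp_space p)) U"
    obtain g x where gx: "U ?e = (g, x)" by (cases "U ?e")
    have atom': "sum.p_atom (g, x)" using sum.p_atom_linear_isometry[OF U atom] by (simp add: gx)
    have g: "g \<in> carrier X" using atom' by (simp add: sum.p_atom_def sum_simps)
    have "vnorm X g = 0" and x: "Y.p_atom x" using p_atom_second[OF p(2) div atom'] by auto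
    hence "g = vscale X 0 f" using X.norm_0_imp[OF g] X.zero_unique[OF g f] by simp
    moreover obtain c where "x = vscale (Sp_space p) c Sp_unit"
      using Sp_p_atom_first_block[OF p x] by blast
    ultimately have "U ?e = vscale (lp_sum p X (Sp_space p)) c ?e"
      using f by (simp add: gx sum_simps X.scale_scale)
    thus "\<exists>c. U ?e = vscale (lp_sum p X (Sp_space p)) c ?e" by blast
  qed
qed

lemma Lp_zero_closed: "abs_ae_fun (\<lambda>_. 0) \<in> carrier (Lp_space p)"
  by (simp add: Lp_space_def Lp_member.abs_eq ae_eq_self)

theorem theorem3p3:
  fixes G :: "('g, 'm) monoid_scheme" and T :: "'g topology" and p :: real
  assumes "topological_group G T" and "locally_compact_space T" and "\<not> compact_space T"
    and "1 \<le> p" and "p \<noteq> 2"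
  shows "(\<nexists>\<pi>. orthogonal_rep G T (Sp_space p) \<pi> \<and> vanishing_coefficients T (Sp_space p) \<pi>) \<and>
    (\<nexists>\<pi>. orthogonal_rep G T (lp_sum p (Lp_space p) (Sp_space p)) \<pi> \<and>
         vanishing_coefficients T (lp_sum p (Lp_space p) (Sp_space p)) \<pi>) \<and>
    \<not> property_H G T (Sp_space p) \<and>
    \<not> property_H G T (lp_sum p (Lp_space p) (Sp_space p))"
proof -
  have top: "topspace T = carrier G"
    using assms(1) by (rule topological_group.topspace_eq)
  have "\<not> (orthogonal_rep G T (Sp_space p) \<pi> \<and> vanishing_coefficients T (Sp_space p) \<pi>)" for \<pi>
    using compact_if_vanishing_coefficients_Sp[OF assms(4,5) top] assms(3) by blast
  moreover have "\<not> (orthogonal_rep G T (lp_sum p (Lp_space p) (Sp_space p)) \<pi> \<and>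
      vanishing_coefficients T (lp_sum p (Lp_space p) (Sp_space p)) \<pi>)" for \<pi>
    using compact_if_vanishing_coefficients_lp_sum_Sp[OF assms(4,5) Lp_space_lp_normed Lp_zero_closed Lp_p_divisible top] assms(3,4)
    by blast
  ultimately show ?thesis unfolding property_H_def by blast
qed

end
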